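(* Let $K\ge1$ and $d\ge1$, and for $k=1,\ldots,K$ let $A_k$ and $B_k$ be positive semidefinite $d\times d$ complex matrices such that $A_kB_k=B_kA_k$ for each $k$. Then \[ \sigma\Big(\sum_{k=1}^K A_kB_k\Big)\prec_w \sigma\Big(\big(\sum_{k=1}^K A_k\big)\big(\sum_{k=1}^K B_k\big)\Big), \] equivalently, for every unitarily invariant norm $|||\cdot|||$ on $d\times d$ matrices, \[ \Big|\Big|\Big|\sum_{k=1}^K A_kB_k\Big|\Big|\Big| \le \Big|\Big|\Big| \big(\sum_{k=1}^K A_k\big)\big(\sum_{k=1}^K B_k\big)\Big|\Big|\Big|. \]
   Context: $\sigma(X)$ denotes the vector of singular values of $X$ sorted in non-increasing order. For real vectors $x,y\in\mathbb{R}^d$, $x\prec_w y$ means $\sum_{i=1}^k x^\downarrow_i\le\sum_{i=1}^k y^\downarrow_i$ for all $k=1,\dots,d$, where $x^\downarrow$ is $x$ sorted non-increasingly. A norm $|||\cdot|||$ is unitarily invariant if $|||UXV|||=|||X|||$ for all unitary $U,V$. *)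

theory Defs
  imports "Jordan_Normal_Form.Schur_Decomposition"
begin

definition psd_mat :: "nat \<Rightarrow> complex mat \<Rightarrow> bool" where
  "psd_mat d A \<longleftrightarrow> A \<in> carrier_mat d d \<and> mat_adjoint A = A \<and>
     (\<forall>v \<in> carrier_vec d. 0 \<le> Re (conjugate v \<bullet> (A *\<^sub>v v)))"

definition msum :: "nat \<Rightarrow> nat \<Rightarrow> (nat \<Rightarrow> complex mat) \<Rightarrow> complex mat" where
  "msum d K M = mat d d (\<lambda>(i,j). \<Sum>k = 1..K. M k $$ (i,j))"

definition sing_vals :: "complex mat \<Rightarrow> real list" where
  "sing_vals X = (THE s. length s = dim_col X \<and> sorted_wrt (\<ge>) s \<and> (\<forall>x \<in> set s. 0 \<le> x) \<and>
      char_poly (mat_adjoint X * X) = (\<Prod>x\<leftarrow>s. [:- complex_of_real (x\<^sup>2), 1:]))"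

definition weak_maj :: "real list \<Rightarrow> real list \<Rightarrow> bool" where
  "weak_maj x y \<longleftrightarrow> length x = length y \<and>
     (\<forall>k \<in> {1..length x}. sum_list (take k (rev (sort x))) \<le> sum_list (take k (rev (sort y))))"

end

theory Submission
  imports Defs
begin

text \<open>
  Put \<open>X\<^sub>j = A\<^sub>j\<^sup>1\<^sup>/\<^sup>2 B\<^sub>j\<^sup>1\<^sup>/\<^sup>2\<close>, which is Hermitian with square \<open>A\<^sub>j B\<^sub>j\<close> because the roots
  commute. Averaging \<open>(\<Sum>\<^sub>j w\<^sub>j X\<^sub>j)\<^sup>2\<close> over all signs gives \<open>\<Sum>\<^sub>j A\<^sub>j B\<^sub>j\<close>, so for some
  signs (depending on \<open>k\<close>) the matrix \<open>M = \<Sum>\<^sub>j w\<^sub>j X\<^sub>j\<close> has the sum of its \<open>k\<close> largest squared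
  eigenvalues at least that of the \<open>k\<close> largest singular values of \<open>\<Sum>\<^sub>j A\<^sub>j B\<^sub>j\<close>. With \<open>S\<close>, \<open>R\<close>
  the square roots of \<open>\<Sum>\<^sub>j A\<^sub>j\<close>, \<open>\<Sum>\<^sub>j B\<^sub>j\<close> one has \<open>M = S C R\<close> for a contraction \<open>C\<close>, and \<open>M\<close>
  has the eigenvalues of \<open>C R S\<close>. Unitary triangularization of \<open>C R S\<close> bounds the squared
  eigenvalues of \<open>M\<close> by the eigenvalues of \<open>S R\<^sup>2 S\<close>, which are those of \<open>S\<^sup>2 R\<^sup>2\<close>; a second
  triangularization and Ky Fan's inequality bound the latter by the singular values of \<open>S\<^sup>2 R\<^sup>2\<close>.
  Orthonormal \<open>k\<close>-frames are represented by the first \<open>k\<close> columns of unitary matrices.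
\<close>

section \<open>Adjoints, column norms and unitary matrices\<close>

abbreviation adj :: "complex mat \<Rightarrow> complex mat" where
  "adj \<equiv> mat_adjoint"

lemma adj_carrier [simp]: "A \<in> carrier_mat n m \<Longrightarrow> adj A \<in> carrier_mat m n"
  unfolding mat_adjoint_def by (auto simp: mat_of_rows_def)

lemma adj_dim [simp]: "dim_row (adj A) = dim_col A" "dim_col (adj A) = dim_row A"
  unfolding mat_adjoint_def by (auto simp: mat_of_rows_def)

lemma adj_index [simp]:
  "i < dim_col A \<Longrightarrow> j < dim_row A \<Longrightarrow> adj A $$ (i,j) = cnj (A $$ (j,i))"
  unfolding mat_adjoint_def by (simp add: mat_of_rows_def)

lemma adj_adj [simp]: "adj (adj A) = A"
  by (rule eq_matI) auto

lemma adj_one [simp]: "adj (1\<^sub>m n) = 1\<^sub>m n"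
  by (rule eq_matI) auto

lemma mult_carrier_square [simp]:
  "A \<in> carrier_mat n n \<Longrightarrow> B \<in> carrier_mat n n \<Longrightarrow> A * B \<in> carrier_mat n n"
  by (rule mult_carrier_mat)

lemma mult_index:
  assumes "A \<in> carrier_mat n m" "B \<in> carrier_mat m l" "i < n" "j < l"
  shows "(A * B) $$ (i,j) = (\<Sum>k<m. A $$ (i,k) * B $$ (k,j))"
  using assms by (auto simp: scalar_prod_def lessThan_atLeast0)

lemma adj_mult:
  assumes "A \<in> carrier_mat n m" "B \<in> carrier_mat m l"
  shows "adj (A * B) = adj B * adj A"
proof (rule eq_matI)
  fix i j assume "i < dim_row (adj B * adj A)" "j < dim_col (adj B * adj A)"
  then have ij: "i < l" "j < n" using assms by auto
  have "adj (A * B) $$ (i,j) = cnj ((A * B) $$ (j,i))" using assms ij by simp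
  also have "\<dots> = (\<Sum>k<m. cnj (A $$ (j,k)) * cnj (B $$ (k,i)))"
    using assms ij by (simp add: mult_index[of A n m B l] del: index_mult_mat)
  also have "\<dots> = (adj B * adj A) $$ (i,j)"
    using assms ij by (simp add: mult_index[of _ l m _ n] mult.commute del: index_mult_mat)
  finally show "adj (A * B) $$ (i,j) = (adj B * adj A) $$ (i,j)" .
qed (use assms in auto)

text \<open>Squared Euclidean length of a column. Norm estimates on a \<open>k\<close>-frame are
  made columnwise: the frame sits in a product \<open>X * V\<close>, of which only the columns
  \<open>i < k\<close> are summed.\<close>

definition col_sq :: "complex mat \<Rightarrow> nat \<Rightarrow> real" where
  "col_sq X i = (\<Sum>l<dim_row X. (cmod (X $$ (l,i)))\<^sup>2)"

lemma col_sq_nonneg [simp]: "0 \<le> col_sq X i"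
  unfolding col_sq_def by (intro sum_nonneg) auto

text \<open>The bridge between lengths and matrix algebra: a column norm becomes a diagonal entry of
  a product, which can then be reassociated and conjugated.\<close>

lemma gram_diag:
  assumes "X \<in> carrier_mat n m" "i < m"
  shows "(adj X * X) $$ (i,i) = complex_of_real (col_sq X i)"
proof -
  have "(adj X * X) $$ (i,i) = (\<Sum>k<n. cnj (X $$ (k,i)) * X $$ (k,i))"
    using assms by (simp add: mult_index[of _ m n _ m] del: index_mult_mat)
  also have "\<dots> = (\<Sum>k<n. complex_of_real ((cmod (X $$ (k,i)))\<^sup>2))"
    by (intro sum.cong refl) (metis complex_norm_square mult.commute)
  finally show ?thesis using assms unfolding col_sq_def by simp
qed

text \<open>The condition is one-sided; since the matrix is square, \<open>unitaryD\<close> recovers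
  the other side.\<close>

definition unitary :: "nat \<Rightarrow> complex mat \<Rightarrow> bool" where
  "unitary d U \<longleftrightarrow> U \<in> carrier_mat d d \<and> adj U * U = 1\<^sub>m d"

lemma unitaryD:
  assumes "unitary d U"
  shows "U \<in> carrier_mat d d" "adj U * U = 1\<^sub>m d" "U * adj U = 1\<^sub>m d"
proof -
  show U: "U \<in> carrier_mat d d" and *: "adj U * U = 1\<^sub>m d"
    using assms by (auto simp: unitary_def)
  show "U * adj U = 1\<^sub>m d"
    by (rule mat_mult_left_right_inverse[OF _ U *]) (use U in auto)
qed

lemma unitary_cancel:
  assumes "unitary d U" "X \<in> carrier_mat d n"
  shows "adj U * (U * X) = X" "U * (adj U * X) = X"
proof -
  note U = unitaryD[OF assms(1)]
  have "adj U * (U * X) = adj U * U * X" "U * (adj U * X) = U * adj U * X"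
    using U(1) assms(2) assoc_mult_mat[of "adj U" d d U d X n]
      assoc_mult_mat[of U d d "adj U" d X n] by simp_all
  then show "adj U * (U * X) = X" "U * (adj U * X) = X"
    unfolding U(2,3) using assms(2) by simp_all
qed

lemma unitary_adjoint: "unitary d U \<Longrightarrow> unitary d (adj U)"
  by (simp add: unitary_def[of d "adj U"] unitaryD)

lemma unitary_mult:
  assumes "unitary d U" "unitary d V"
  shows "unitary d (U * V)"
proof -
  note U = unitaryD[OF assms(1)] and V = unitaryD[OF assms(2)]
  have "adj (U * V) * (U * V) = adj V * (adj U * (U * V))"
    using U V adj_mult[of U d d V d] assoc_mult_mat[of "adj V" d d "adj U" d "U * V" d] by simp
  then show ?thesis
    using U V unitary_cancel(1)[OF assms(1) V(1)] by (simp add: unitary_def)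
qed

lemma col_sq_unitary:
  assumes "unitary d U" "X \<in> carrier_mat d n" "i < n"
  shows "col_sq (U * X) i = col_sq X i"
proof -
  note U = unitaryD[OF assms(1)]
  have "adj (U * X) * (U * X) = adj X * (adj U * (U * X))"
    using U assms adj_mult[of U d d X n] assoc_mult_mat[of "adj X" n d "adj U" d "U * X" n] by simp
  then have "adj (U * X) * (U * X) = adj X * X"
    by (simp only: unitary_cancel(1)[OF assms(1,2)])
  then have "complex_of_real (col_sq (U * X) i) = complex_of_real (col_sq X i)"
    using U assms gram_diag[of "U * X" d n i] gram_diag[of X d n i] by simp
  then show ?thesis by simp
qed

lemma col_sq_one: "i < d \<Longrightarrow> col_sq (1\<^sub>m d) i = 1"
  using gram_diag[of "1\<^sub>m d" d d i] by simp

lemma unitary_col_sq: "unitary d U \<Longrightarrow> i < d \<Longrightarrow> col_sq U i = 1"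
  using col_sq_unitary[of d U "1\<^sub>m d" d i] unitaryD(1)[of d U] col_sq_one[of i d] by simp

abbreviation rdiag :: "nat \<Rightarrow> (nat \<Rightarrow> real) \<Rightarrow> complex mat" where
  "rdiag d f \<equiv> mat_diag d (\<lambda>i. complex_of_real (f i))"

lemma adjoint_rdiag [simp]: "adj (rdiag d f) = rdiag d f"
  by (rule eq_matI) (auto simp: mat_diag_def)

lemma unitary_conj:
  assumes "unitary d U" "X \<in> carrier_mat d d"
  shows "U * (adj U * X * U) * adj U = X" "adj U * (U * X * adj U) * U = X"
proof -
  note U = unitaryD[OF assms(1)]
  have "U * (adj U * X * U) = X * U"
    using U(1) assms unitary_cancel(2)[OF assms(1), of "X * U" d]
      assoc_mult_mat[of "adj U" d d X d U d] by simp
  moreover have "X * U * adj U = X"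
    using U assms(2) assoc_mult_mat[of X d d U d "adj U" d] by simp
  ultimately show "U * (adj U * X * U) * adj U = X" by simp
  have "adj U * (U * X * adj U) = X * adj U"
    using U(1) assms unitary_cancel(1)[OF assms(1), of "X * adj U" d]
      assoc_mult_mat[of U d d X d "adj U" d] by simp
  moreover have "X * adj U * U = X"
    using U assms(2) assoc_mult_mat[of X d d "adj U" d U d] by simp
  ultimately show "adj U * (U * X * adj U) * U = X" by simp
qed

lemma unitary_conj_mult:
  assumes "unitary d U" "X \<in> carrier_mat d d" "Y \<in> carrier_mat d d"
  shows "(U * X * adj U) * (U * Y * adj U) = U * (X * Y) * adj U"
proof -
  note U = unitaryD[OF assms(1)]
  have "(U * X * adj U) * (U * Y * adj U) = U * X * (adj U * (U * (Y * adj U)))"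
    using U assms by (simp add: assoc_mult_mat[of _ d d _ d _ d])
  also have "\<dots> = U * X * (Y * adj U)"
    using assms U by (subst unitary_cancel(1)[OF assms(1)]) auto
  finally show ?thesis using U assms by (simp add: assoc_mult_mat[of _ d d _ d _ d])
qed

subsection \<open>Characteristic polynomials\<close>

text \<open>Used with \<open>four_block_mat\<close>, to compare block matrices block by
  block.\<close>

lemma arg_cong4: "a = a' \<Longrightarrow> b = b' \<Longrightarrow> c = c' \<Longrightarrow> d = d' \<Longrightarrow> f a b c d = f a' b' c' d'"
  by simp

lemma char_poly_intertwined:
  fixes L P Q R :: "'a :: comm_ring_1 mat"
  assumes "L * P = P * R" "P * Q = 1\<^sub>m n" "Q * P = 1\<^sub>m n"
    and "L \<in> carrier_mat n n" "P \<in> carrier_mat n n" "Q \<in> carrier_mat n n" "R \<in> carrier_mat n n"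
  shows "char_poly L = char_poly R"
proof -
  have "L * P * Q = L" using assms assoc_mult_mat[of L n n P n Q n] by simp
  then have "similar_mat_wit L R P Q"
    using assms by (intro similar_mat_witI[of _ _ n]) simp_all
  then show ?thesis
    by (intro char_poly_similar) (auto simp: similar_mat_def)
qed

text \<open>To cover singular factors, pass to size \<open>n + n\<close>: the unipotent
  \<open>?P\<close> makes the block triangular \<open>?L\<close> and \<open>?R\<close> similar, and
  each has a zero block on its diagonal, so the factor \<open>char_poly ?z\<close> cancels.\<close>

lemma char_poly_mult_commute:
  fixes A B :: "complex mat"
  assumes A: "A \<in> carrier_mat n n" and B: "B \<in> carrier_mat n n"
  shows "char_poly (A * B) = char_poly (B * A)"
proof -
  let ?z = "0\<^sub>m n n :: complex mat" and ?I = "1\<^sub>m n :: complex mat"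
  let ?L = "four_block_mat (A * B) ?z B ?z" and ?R = "four_block_mat ?z ?z B (B * A)"
  let ?P = "four_block_mat ?I A ?z ?I" and ?Q = "four_block_mat ?I (- A) ?z ?I"
  have ex: "\<exists>es. char_poly X = (\<Prod>a\<leftarrow>es. [:- a, 1:])" if "X \<in> carrier_mat n n" for X :: "complex mat"
    using char_poly_factorized[OF that] by auto
  note mult = mult_four_block_mat[of _ n n _ n _ n _ _ n _ n]
  have zero: "- ?z = ?z" "A + - A = ?z" "- A + A = ?z"
    using A by (auto intro!: eq_matI)
  have one: "four_block_mat ?I ?z ?z ?I = 1\<^sub>m (n + n)"
    by (rule four_block_one_mat)
  have "?P * ?Q = four_block_mat (?I * ?I + A * ?z) (?I * - A + A * ?I) (?z * ?I + ?I * ?z) (?z * - A + ?I * ?I)"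
    by (rule mult) (use A in auto)
  also have "\<dots> = 1\<^sub>m (n + n)"
    unfolding one[symmetric] by (rule arg_cong4[where f = four_block_mat]) (use A zero in auto)
  finally have PQ: "?P * ?Q = 1\<^sub>m (n + n)" .
  have "?Q * ?P = four_block_mat (?I * ?I + - A * ?z) (?I * A + - A * ?I) (?z * ?I + ?I * ?z) (?z * A + ?I * ?I)"
    by (rule mult) (use A in auto)
  also have "\<dots> = 1\<^sub>m (n + n)"
    unfolding one[symmetric] by (rule arg_cong4[where f = four_block_mat]) (use A zero in auto)
  finally have QP: "?Q * ?P = 1\<^sub>m (n + n)" .
  have "?L * ?P = four_block_mat (A * B * ?I + ?z * ?z) (A * B * A + ?z * ?I) (B * ?I + ?z * ?z) (B * A + ?z * ?I)"
    by (rule mult) (use A B in auto)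
  also have "\<dots> = four_block_mat (?I * ?z + A * B) (?I * ?z + A * (B * A)) (?z * ?z + ?I * B) (?z * ?z + ?I * (B * A))"
    by (rule arg_cong4[where f = four_block_mat]) (use A B in \<open>auto simp: assoc_mult_mat[of _ n n _ n _ n]\<close>)
  also have "\<dots> = ?P * ?R"
    by (rule mult[symmetric]) (use A B in auto)
  finally have "?L * ?P = ?P * ?R" .
  then have "char_poly ?L = char_poly ?R"
    by (rule char_poly_intertwined[OF _ PQ QP]) (use A B in auto)
  moreover have "char_poly ?L = char_poly (A * B) * char_poly ?z"
    by (rule char_poly_0_block'[OF refl ex ex]) (use A B in auto)
  moreover have "char_poly ?R = char_poly ?z * char_poly (B * A)"
    by (rule char_poly_0_block'[OF refl ex ex]) (use A B in auto)
  moreover have "char_poly ?z \<noteq> 0"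
    using degree_monic_char_poly[of ?z n] by auto
  ultimately show ?thesis by (simp add: mult.commute)
qed

text \<open>Unique factorization, dividing out one common root at a time. Multiplicities count,
  hence multisets.\<close>

lemma prod_linear_inj:
  fixes xs ys :: "'a :: field list"
  assumes "(\<Prod>x\<leftarrow>xs. [:- x, 1:]) = (\<Prod>x\<leftarrow>ys. [:- x, 1:])"
  shows "mset xs = mset ys"
  using assms
proof (induction xs arbitrary: ys)
  case Nil
  have "degree (\<Prod>x\<leftarrow>ys. [:- x, 1:]) = length ys"
    by (rule degree_linear_factors)
  then show ?case unfolding Nil[symmetric] by simp
next
  case (Cons a xs)
  have "poly (\<Prod>x\<leftarrow>ys. [:- x, 1:]) a = 0"
    by (simp add: Cons.prems[symmetric])
  then have "a \<in> set ys"
    by (auto simp: poly_prod_list prod_list_zero_iff)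
  then obtain us vs where ys: "ys = us @ a # vs" by (auto simp: in_set_conv_decomp)
  have "(\<Prod>x\<leftarrow>ys. [:- x, 1:]) = [:- a, 1:] * (\<Prod>x\<leftarrow>us @ vs. [:- x, 1:])"
    unfolding ys map_append list.map prod_list.append prod_list.Cons by (rule mult.left_commute)
  then have "[:- a, 1:] * (\<Prod>x\<leftarrow>xs. [:- x, 1:]) = [:- a, 1:] * (\<Prod>x\<leftarrow>us @ vs. [:- x, 1:])"
    unfolding Cons.prems[symmetric] list.map prod_list.Cons .
  moreover have "[:- a, 1:] \<noteq> 0" by simp
  ultimately have "(\<Prod>x\<leftarrow>xs. [:- x, 1:]) = (\<Prod>x\<leftarrow>us @ vs. [:- x, 1:])"
    unfolding mult_cancel_left by blast
  from Cons.IH[OF this] show ?case by (simp add: ys)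
qed

lemma char_poly_unitary_rdiag:
  assumes "unitary d U"
  shows "char_poly (U * rdiag d f * adj U) = (\<Prod>i\<leftarrow>[0..<d]. [:- complex_of_real (f i), 1:])"
proof -
  note U = unitaryD[OF assms]
  have "similar_mat_wit (U * rdiag d f * adj U) (rdiag d f) U (adj U)"
    using U by (intro similar_mat_witI[of _ _ d]) auto
  then have "char_poly (U * rdiag d f * adj U) = char_poly (rdiag d f)"
    by (intro char_poly_similar) (auto simp: similar_mat_def)
  also have "\<dots> = (\<Prod>a\<leftarrow>diag_mat (rdiag d f). [:- a, 1:])"
    by (rule char_poly_upper_triangular[of _ d]) (auto simp: mat_diag_def)
  also have "diag_mat (rdiag d f) = map (\<lambda>i. complex_of_real (f i)) [0..<d]"
    by (auto simp: diag_mat_def mat_diag_def)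
  finally show ?thesis by (simp add: comp_def)
qed

subsection \<open>Unitary triangularization\<close>

text \<open>Complete \<open>v\<close> to a basis, orthogonalize by Gram-Schmidt, which keeps the
  first vector, and normalize. The scalar \<open>c\<close> is the reciprocal of the length of
  \<open>v\<close>.\<close>

lemma unitary_first_column:
  fixes v :: "complex vec"
  assumes v: "v \<in> carrier_vec n" and v0: "v \<noteq> 0\<^sub>v n"
  obtains W c where "unitary n W" "col W 0 = c \<cdot>\<^sub>v v"
proof -
  interpret cof_vec_space n "TYPE(complex)" .
  define ws where "ws = gram_schmidt n (basis_completion v)"
  note b = basis_completion[OF v v0]
  have n: "n \<noteq> 0"
  proof
    assume "n = 0"
    then have "v = 0\<^sub>v n" using v by (intro eq_vecI) auto
    with v0 show False by simp
  qed
  from b(6,7) n obtain vs where bv: "basis_completion v = v # vs"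
    by (cases "basis_completion v") auto
  from gram_schmidt_result[OF b(2,4,5) ws_def] b(6)
  have ws: "corthogonal ws" "set ws \<subseteq> carrier_vec n" "length ws = n" by auto
  have "hd ws = v" unfolding ws_def bv by (rule gram_schmidt_hd[OF v])
  then have ws0: "ws ! 0 = v" using ws(3) n by (cases ws) auto
  have wc: "ws ! j \<in> carrier_vec n" if "j < n" for j using ws that by auto
  define r where "r j = sqrt (\<Sum>l<n. (cmod (ws ! j $ l))\<^sup>2)" for j
  have ip: "ws ! j \<bullet>c ws ! i = (\<Sum>l<n. cnj (ws ! i $ l) * ws ! j $ l)" if "i < n" "j < n" for i j
    using wc[OF that(1)] wc[OF that(2)]
    by (auto simp: scalar_prod_def lessThan_atLeast0 mult.commute intro!: sum.cong)
  have rr: "(\<Sum>l<n. cnj (ws ! j $ l) * ws ! j $ l) = complex_of_real (r j * r j)" for j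
  proof -
    have "(\<Sum>l<n. cnj (ws ! j $ l) * ws ! j $ l) = (\<Sum>l<n. complex_of_real ((cmod (ws ! j $ l))\<^sup>2))"
      by (intro sum.cong refl) (metis complex_norm_square mult.commute)
    moreover have "0 \<le> (\<Sum>l<n. (cmod (ws ! j $ l))\<^sup>2)" by (intro sum_nonneg) auto
    ultimately show ?thesis by (simp add: r_def)
  qed
  \<comment> \<open>\<open>corthogonal\<close> is an equivalence: inner products vanish exactly for
    distinct indices, so no vector of the list has length zero.\<close>
  have r0: "r j \<noteq> 0" if "j < n" for j
    using corthogonalD[OF ws(1), of j j] ws(3) that ip[of j j] rr[of j] by auto
  define W where "W = mat n n (\<lambda>(l,j). ws ! j $ l / complex_of_real (r j))"
  have W: "W \<in> carrier_mat n n" unfolding W_def by simp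
  have "adj W * W = 1\<^sub>m n"
  proof (rule eq_matI)
    fix i j assume "i < dim_row (1\<^sub>m n :: complex mat)" "j < dim_col (1\<^sub>m n :: complex mat)"
    then have ij: "i < n" "j < n" by auto
    have "(adj W * W) $$ (i,j) = (\<Sum>l<n. cnj (W $$ (l,i)) * W $$ (l,j))"
      using W ij by (simp add: mult_index[of _ n n _ n] del: index_mult_mat)
    also have "\<dots> = (\<Sum>l<n. cnj (ws ! i $ l) * ws ! j $ l) / complex_of_real (r i * r j)"
      unfolding sum_divide_distrib using ij by (intro sum.cong) (auto simp: W_def)
    also have "\<dots> = 1\<^sub>m n $$ (i,j)"
    proof (cases "i = j")
      case True
      then show ?thesis using r0 ij by (simp add: rr)
    next
      case False
      then have "ws ! j \<bullet>c ws ! i = 0"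
        using corthogonalD[OF ws(1), of j i] ws(3) ij by auto
      then show ?thesis using False ij by (simp add: ip)
    qed
    finally show "(adj W * W) $$ (i,j) = 1\<^sub>m n $$ (i,j)" .
  qed (use W in auto)
  moreover have "col W 0 = (1 / complex_of_real (r 0)) \<cdot>\<^sub>v v"
    using n v by (intro eq_vecI) (auto simp: W_def ws0)
  ultimately show thesis using W that by (auto simp: unitary_def)
qed

lemma char_poly_unitary_conj:
  assumes "unitary d U" "X \<in> carrier_mat d d"
  shows "char_poly (U * X * adj U) = char_poly X"
proof -
  note U = unitaryD[OF assms(1)]
  have "similar_mat_wit (U * X * adj U) X U (adj U)"
    using U assms by (intro similar_mat_witI[of _ _ d]) auto
  then show ?thesis by (intro char_poly_similar) (auto simp: similar_mat_def)
qed

text \<open>Schur's theorem by deflation: an eigenvector for the head of \<open>es\<close>, as first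
  column of a unitary matrix, splits off a 1 by 1 block, and induction treats the rest. Any listing
  of the roots can be realized as the diagonal, so sorted eigenvalues are available later.\<close>

lemma unitary_schur:
  assumes "A \<in> carrier_mat n n" "char_poly A = (\<Prod>e\<leftarrow>es. [:- e, 1:])"
  shows "\<exists>U T. unitary n U \<and> T \<in> carrier_mat n n \<and> upper_triangular T \<and> diag_mat T = es \<and>
    A = U * T * adj U"
  using assms
proof (induction es arbitrary: n A)
  case Nil
  have "n = degree (char_poly A)" using degree_monic_char_poly[OF Nil(1)] by simp
  then have "n = 0" unfolding Nil(2) by simp
  then show ?case using Nil(1)
    by (intro exI[of _ "1\<^sub>m 0"] exI[of _ A]) (auto simp: unitary_def diag_mat_def)
next
  case (Cons e es)
  note A = Cons.prems(1)
  have "eigenvalue A e"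
    unfolding eigenvalue_root_char_poly[OF A] Cons.prems(2) by simp
  then obtain v where "eigenvector A v e" unfolding eigenvalue_def by auto
  then have v: "v \<in> carrier_vec n" "v \<noteq> 0\<^sub>v n" "A *\<^sub>v v = e \<cdot>\<^sub>v v"
    using A by (auto simp: eigenvector_def)
  obtain W c where W: "unitary n W" and W0: "col W 0 = c \<cdot>\<^sub>v v"
    using unitary_first_column[OF v(1,2)] .
  note W' = unitaryD[OF W]
  have "n \<noteq> 0"
  proof
    assume "n = 0"
    then have "v = 0\<^sub>v n" using v by (intro eq_vecI) auto
    with v(2) show False by simp
  qed
  then obtain m where n: "n = 1 + m" by (cases n) auto
  define A' where "A' = adj W * A * W"
  have A': "A' \<in> carrier_mat n n" using W' A by (simp add: A'_def)
  have AW: "A = W * A' * adj W" unfolding A'_def by (rule unitary_conj(1)[OF W A, symmetric])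
  \<comment> \<open>Column 0 of \<open>W\<close> is a multiple of the eigenvector; applying
    \<open>adj W\<close> will show that column 0 of \<open>A'\<close> is \<open>e\<close> times the
    first unit vector.\<close>
  have "col (A * W) 0 = e \<cdot>\<^sub>v col W 0"
  proof -
    have "col (A * W) 0 = A *\<^sub>v col W 0" using W' A n by (intro col_mult2[of _ n n _ n]) auto
    also have "\<dots> = c \<cdot>\<^sub>v (A *\<^sub>v v)" unfolding W0 using A v by (intro mult_mat_vec) auto
    also have "\<dots> = e \<cdot>\<^sub>v col W 0"
      unfolding v W0 smult_smult_assoc by (simp add: mult.commute)
    finally show ?thesis .
  qed
  moreover have "col W 0 \<in> carrier_vec n" using W'(1) col_dim[of W 0] by simp
  ultimately have "adj W *\<^sub>v col (A * W) 0 = e \<cdot>\<^sub>v (adj W *\<^sub>v col W 0)"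
    using mult_mat_vec[OF adj_carrier[OF W'(1)], of "col W 0" e] by simp
  moreover have "adj W *\<^sub>v col (A * W) 0 = col A' 0"
    using W' A n col_mult2[of "adj W" n n "A * W" n 0] assoc_mult_mat[of "adj W" n n A n W n]
    by (simp add: A'_def)
  moreover have "adj W *\<^sub>v col W 0 = col (1\<^sub>m n) 0"
    using W' n col_mult2[of "adj W" n n W n 0] by simp
  ultimately have c0: "col A' 0 = e \<cdot>\<^sub>v col (1\<^sub>m n) 0" by simp
  have A'0: "A' $$ (i,0) = (if i = 0 then e else 0)" if "i < n" for i
    using arg_cong[OF c0, of "\<lambda>v. v $ i"] A' that n by (auto split: if_splits)
  obtain A1 A2 A0 A3 where sp: "split_block A' 1 1 = (A1,A2,A0,A3)"
    by (cases "split_block A' 1 1") auto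
  from split_block[OF sp, of m m] A' n
  have car: "A1 \<in> carrier_mat 1 1" "A2 \<in> carrier_mat 1 m" "A0 \<in> carrier_mat m 1" "A3 \<in> carrier_mat m m"
    and blk: "A' = four_block_mat A1 A2 A0 A3" by auto
  have A1id: "A1 = mat 1 1 (\<lambda>_. e)"
    using sp[unfolded split_block_def Let_def] A'0[of 0] n by auto
  have A0id: "A0 = 0\<^sub>m m 1"
    using sp[unfolded split_block_def Let_def] A' n by (auto simp: A'0 intro!: eq_matI)
  have cpA: "char_poly A' = char_poly A" unfolding AW
    by (rule char_poly_unitary_conj[OF W A', symmetric])
  have cp1: "char_poly A1 = [:- e, 1:]"
    by (simp add: A1id char_poly_defs det_def sign_def)
  have "char_poly A' = char_poly A1 * char_poly A3"
    unfolding blk A0id by (rule char_poly_four_block_zeros_col[OF car(1,2,4)])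
  then have eq: "[:- e, 1:] * char_poly A3 = [:- e, 1:] * (\<Prod>e\<leftarrow>es. [:- e, 1:])"
    unfolding cpA Cons.prems(2) cp1 list.map prod_list.Cons by (rule sym)
  have "[:- e, 1:] \<noteq> 0" by simp
  with eq have "char_poly A3 = (\<Prod>e\<leftarrow>es. [:- e, 1:])"
    unfolding mult_cancel_left by blast
  from Cons.IH[OF car(4) this] obtain U T where U: "unitary m U" and T: "T \<in> carrier_mat m m"
    "upper_triangular T" "diag_mat T = es" and A3: "A3 = U * T * adj U" by blast
  note U' = unitaryD[OF U]
  \<comment> \<open>The unitary of the smaller block is padded by a 1. This turns the corner row
    \<open>A2\<close> into \<open>A2 * U\<close>, which does not disturb triangularity.\<close>
  define Z where "Z = four_block_mat (1\<^sub>m 1) (0\<^sub>m 1 m) (0\<^sub>m m 1) U"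
  define R where "R = four_block_mat A1 (A2 * U) (0\<^sub>m m 1) T"
  have Zc: "Z \<in> carrier_mat n n" and Rc: "R \<in> carrier_mat n n"
    unfolding Z_def R_def n using U' T car by auto
  have adjZ: "adj Z = four_block_mat (1\<^sub>m 1) (0\<^sub>m 1 m) (0\<^sub>m m 1) (adj U)"
    unfolding Z_def using U' by (intro eq_matI) auto
  have "adj Z * Z = four_block_mat (1\<^sub>m 1) (0\<^sub>m 1 m) (0\<^sub>m m 1) (1\<^sub>m m)"
    unfolding adjZ unfolding Z_def using U'
    by (subst mult_four_block_mat[of _ 1 1 _ m _ m _ _ 1 _ m]) auto
  then have Z: "unitary n Z" using Zc n by (simp add: unitary_def)
  have "Z * R = four_block_mat A1 (A2 * U) (0\<^sub>m m 1) (U * T)"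
    unfolding Z_def R_def using U' T car
    by (subst mult_four_block_mat[of _ 1 1 _ m _ m _ _ 1 _ m]) auto
  moreover have "\<dots> * adj Z = four_block_mat A1 A2 (0\<^sub>m m 1) (U * T * adj U)"
    unfolding adjZ using U' T car
    by (subst mult_four_block_mat[of _ 1 1 _ m _ m _ _ 1 _ m]) (auto simp: assoc_mult_mat[of A2 1 m U m "adj U" m])
  ultimately have "Z * R * adj Z = A'"
    unfolding blk A0id A3 by simp
  then have "A = W * (Z * R * adj Z) * adj W" using AW by simp
  also have "\<dots> = (W * Z) * R * (adj Z * adj W)"
    using W'(1) Zc Rc by (simp add: assoc_mult_mat[of _ n n _ n _ n])
  also have "adj Z * adj W = adj (W * Z)"
    using W'(1) Zc by (simp add: adj_mult[of W n n Z n])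
  finally have "A = (W * Z) * R * adj (W * Z)" .
  moreover have "upper_triangular R"
    unfolding R_def by (rule upper_triangular_four_block) (use car T A1id in auto)
  moreover have "diag_mat R = e # es"
    unfolding R_def using diag_four_block_mat[OF car(1) T(1)] T(3) A1id by (simp add: diag_mat_def)
  ultimately show ?case using unitary_mult[OF W Z] Rc by blast
qed

text \<open>Unitary triangularization preserves self-adjointness, and a self-adjoint upper
  triangular matrix is real diagonal. The key \<kappa> fixes the listing of the eigenvalues; it is
  taken to be the identity or the square.\<close>

lemma hermitian_spectral:
  assumes A: "A \<in> carrier_mat d d" and H: "adj A = A"
  obtains U f where "unitary d U" "A = U * rdiag d f * adj U"
    "\<And>i j. i \<le> j \<Longrightarrow> j < d \<Longrightarrow> \<kappa> (f j) \<le> (\<kappa> (f i) :: real)"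
proof -
  obtain es0 where es0: "char_poly A = (\<Prod>a\<leftarrow>es0. [:- a, 1:])" "length es0 = d"
    using char_poly_factorized[OF A] by auto
  \<comment> \<open>Ascending order of the negated key is descending order of the key. The roots are
    still complex numbers here, hence \<open>Re\<close>; that they are real follows from the
    diagonal of \<open>T\<close>.\<close>
  define es where "es = sort_key (\<lambda>e. - \<kappa> (Re e)) es0"
  have "mset (map (\<lambda>a. [:- a, 1:]) es) = mset (map (\<lambda>a. [:- a, 1:]) es0)"
    by (simp add: es_def)
  then have "(\<Prod>a\<leftarrow>es. [:- a, 1:]) = (\<Prod>a\<leftarrow>es0. [:- a, 1:])"
    by (metis prod_mset_prod_list)
  then have "char_poly A = (\<Prod>a\<leftarrow>es. [:- a, 1:])" using es0 by simp
  from unitary_schur[OF A this] obtain U T where U: "unitary d U" and T: "T \<in> carrier_mat d d"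
    "upper_triangular T" "diag_mat T = es" and AT: "A = U * T * adj U" by blast
  note U' = unitaryD[OF U]
  have TA: "T = adj U * A * U" unfolding AT by (rule unitary_conj(2)[OF U T(1), symmetric])
  have "adj T = T"
    unfolding TA using U' A H
    by (simp add: adj_mult[of _ d d _ d] assoc_mult_mat[of _ d d _ d _ d])
  then have sym: "T $$ (i,j) = cnj (T $$ (j,i))" if "i < d" "j < d" for i j
    using adj_index[of i T j] T(1) that by simp
  define f where "f i = Re (T $$ (i,i))" for i
  have "T = rdiag d f"
  proof (rule eq_matI)
    fix i j assume "i < dim_row (rdiag d f)" "j < dim_col (rdiag d f)"
    then have ij: "i < d" "j < d" by (auto simp: mat_diag_def)
    show "T $$ (i,j) = rdiag d f $$ (i,j)"
    proof (cases i j rule: linorder_cases)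
      case less
      then show ?thesis using sym[OF ij] ij T(1,2) by (auto simp: mat_diag_def)
    next
      case equal
      then show ?thesis using sym[OF ij] ij by (auto simp: mat_diag_def f_def complex_eq_iff)
    next
      case greater
      then show ?thesis using ij T(1,2) by (auto simp: mat_diag_def)
    qed
  qed (use T(1) in \<open>auto simp: mat_diag_def\<close>)
  moreover have "\<kappa> (f j) \<le> \<kappa> (f i)" if "i \<le> j" "j < d" for i j
  proof -
    have nth: "es ! l = T $$ (l,l)" if "l < d" for l
      using that T(1) unfolding T(3)[symmetric] by (simp add: diag_mat_def)
    have "sorted (map (\<lambda>e. - \<kappa> (Re e)) es)" "length es = d"
      by (simp_all add: es_def es0)
    then have "- \<kappa> (Re (es ! i)) \<le> - \<kappa> (Re (es ! j))"
      using sorted_nth_mono[of "map (\<lambda>e. - \<kappa> (Re e)) es" i j] that by simp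
    then show ?thesis using that by (simp add: nth f_def)
  qed
  ultimately show thesis using that[OF U] AT by metis
qed

subsection \<open>Singular values\<close>

lemma sorted_ge_mset_unique:
  fixes xs ys :: "real list"
  assumes "sorted_wrt (\<ge>) xs" "sorted_wrt (\<ge>) ys" "mset xs = mset ys"
  shows "xs = ys"
proof -
  have "sorted (rev xs)" "sorted (rev ys)" using assms by (auto simp: sorted_wrt_rev)
  then have "sort (rev ys) = rev xs" "sort (rev ys) = rev ys"
    using assms(3) by (auto intro: properties_for_sort)
  then show ?thesis by simp
qed

text \<open>Resolves the definite description in \<open>sing_vals\<close>: the characteristic
  polynomial fixes the multiset of squares, nonnegativity fixes the values, and sortedness fixes the
  order.\<close>

lemma sing_vals_eqI:
  assumes X: "X \<in> carrier_mat d d" and V: "unitary d V"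
    and XX: "adj X * X = V * rdiag d (\<lambda>i. (s i)\<^sup>2) * adj V"
    and nonneg: "\<And>i. i < d \<Longrightarrow> 0 \<le> s i"
    and anti: "\<And>i j. i \<le> j \<Longrightarrow> j < d \<Longrightarrow> s j \<le> s i"
  shows "sing_vals X = map s [0..<d]"
proof -
  let ?s = "map s [0..<d]"
  have cp: "char_poly (adj X * X) = (\<Prod>x\<leftarrow>?s. [:- complex_of_real (x\<^sup>2), 1:])"
    unfolding XX char_poly_unitary_rdiag[OF V] by (simp add: comp_def)
  have srt: "sorted_wrt (\<ge>) ?s"
    using anti by (auto simp: sorted_wrt_iff_nth_less)
  show ?thesis unfolding sing_vals_def
  proof (rule the_equality)
    show "length ?s = dim_col X \<and> sorted_wrt (\<ge>) ?s \<and> (\<forall>x\<in>set ?s. 0 \<le> x) \<and>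
      char_poly (adj X * X) = (\<Prod>x\<leftarrow>?s. [:- complex_of_real (x\<^sup>2), 1:])"
      using X srt cp nonneg by auto
  next
    fix t assume t: "length t = dim_col X \<and> sorted_wrt (\<ge>) t \<and> (\<forall>x\<in>set t. 0 \<le> x) \<and>
      char_poly (adj X * X) = (\<Prod>x\<leftarrow>t. [:- complex_of_real (x\<^sup>2), 1:])"
    have "(\<Prod>y\<leftarrow>map (\<lambda>x. complex_of_real (x\<^sup>2)) t. [:- y, 1:]) =
        (\<Prod>y\<leftarrow>map (\<lambda>x. complex_of_real (x\<^sup>2)) ?s. [:- y, 1:])"
      using t cp unfolding map_map comp_def by simp
    \<comment> \<open>Mapping \<open>sqrt (Re z)\<close> over both multisets undoes the squaring, as
      the lists are nonnegative.\<close>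
    from prod_linear_inj[OF this]
    have "mset (map (\<lambda>z. sqrt (Re z)) (map (\<lambda>x. complex_of_real (x\<^sup>2)) t)) =
        mset (map (\<lambda>z. sqrt (Re z)) (map (\<lambda>x. complex_of_real (x\<^sup>2)) ?s))"
      unfolding mset_map[of "\<lambda>z. sqrt (Re z)"] by (rule arg_cong)
    moreover have "map (\<lambda>z. sqrt (Re z)) (map (\<lambda>x. complex_of_real (x\<^sup>2)) u) = u"
      if "\<forall>x\<in>set u. 0 \<le> x" for u
      unfolding map_map comp_def using that by (intro map_idI) auto
    moreover have "\<forall>x\<in>set ?s. 0 \<le> x" using nonneg by auto
    ultimately have "mset t = mset ?s" using t by metis
    then show "t = ?s" using t srt by (intro sorted_ge_mset_unique) auto
  qed
qed

text \<open>The eigenvalues of \<open>adj X * X\<close> are squared column lengths of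
  \<open>X * V\<close>, hence nonnegative, and \<open>s\<close> consists of their square
  roots.\<close>

lemma sing_vals_exist:
  assumes X: "X \<in> carrier_mat d d"
  obtains V s where "unitary d V" "adj X * X = V * rdiag d (\<lambda>i. (s i)\<^sup>2) * adj V"
    "\<And>i. i < d \<Longrightarrow> 0 \<le> s i" "\<And>i j. i \<le> j \<Longrightarrow> j < d \<Longrightarrow> s j \<le> s i"
proof -
  have XX: "adj X * X \<in> carrier_mat d d" "adj (adj X * X) = adj X * X"
    using X by (auto simp: adj_mult[of _ d d _ d])
  obtain V f where V: "unitary d V" and eq: "adj X * X = V * rdiag d f * adj V"
    and anti: "\<And>i j. i \<le> j \<Longrightarrow> j < d \<Longrightarrow> f j \<le> f i"
    using hermitian_spectral[OF XX, of "\<lambda>x. x"] by metis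
  note V' = unitaryD[OF V]
  have "adj (X * V) * (X * V) = adj V * (adj X * X) * V"
    using X V' by (simp add: adj_mult[of _ d d _ d] assoc_mult_mat[of _ d d _ d _ d])
  also have "\<dots> = rdiag d f"
    unfolding eq by (rule unitary_conj(2)[OF V]) simp
  finally have "complex_of_real (f i) = complex_of_real (col_sq (X * V) i)" if "i < d" for i
    using gram_diag[of "X * V" d d i] X V' that by (simp add: mat_diag_def)
  then have f: "0 \<le> f i" if "i < d" for i using that by simp
  have "rdiag d f = rdiag d (\<lambda>i. (sqrt (f i))\<^sup>2)"
    using f by (intro eq_matI) (auto simp: mat_diag_def simp flip: of_real_power)
  with eq f anti V that[of V "\<lambda>i. sqrt (f i)"] show thesis by simp
qed

subsection \<open>Ky Fan inequalities\<close>

text \<open>With capacities at most 1 and total mass at most \<open>k\<close>, all mass is best put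
  on the \<open>k\<close> largest values. Subtracting a threshold \<open>t\<close> from the values
  makes this a termwise comparison.\<close>

lemma weighted_sum_le_top_sum:
  fixes s m :: "nat \<Rightarrow> real"
  assumes "\<And>i. i < d \<Longrightarrow> 0 \<le> s i" "\<And>i j. i \<le> j \<Longrightarrow> j < d \<Longrightarrow> s j \<le> s i"
    and m: "\<And>j. j < d \<Longrightarrow> 0 \<le> m j" "\<And>j. j < d \<Longrightarrow> m j \<le> 1"
    and "(\<Sum>j<d. m j) \<le> real k" "k \<le> d"
  shows "(\<Sum>j<d. s j * m j) \<le> (\<Sum>j<k. s j)"
proof -
  \<comment> \<open>The threshold separates the first \<open>k\<close> values from the rest; for
    \<open>k = d\<close> nothing is left out and 0 serves. It has to be nonnegative because the
    total mass may stay below \<open>k\<close>.\<close>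
  define t where "t = (if k < d then s k else 0)"
  have t0: "0 \<le> t" using assms(1) by (simp add: t_def)
  have "(s j - t) * m j \<le> (if j < k then s j - t else 0)" if j: "j < d" for j
  proof (cases "j < k")
    case True
    then have "0 \<le> s j - t" using assms(1,2) j \<open>k \<le> d\<close> by (auto simp: t_def)
    then show ?thesis using True m(2)[OF j] mult_left_le by fastforce
  next
    case False
    then have "s j - t \<le> 0" using assms(2)[of k j] j by (auto simp: t_def)
    then show ?thesis using False m(1)[OF j] by (simp add: mult_nonpos_nonneg)
  qed
  then have "(\<Sum>j<d. (s j - t) * m j) \<le> (\<Sum>j<d. if j < k then s j - t else 0)"
    by (intro sum_mono) auto
  also have "\<dots> = (\<Sum>j<k. s j - t)"
    using \<open>k \<le> d\<close> by (intro sum.mono_neutral_cong_right) auto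
  also have "\<dots> = (\<Sum>j<k. s j) - real k * t" by (simp add: sum_subtractf)
  finally have "(\<Sum>j<d. s j * m j) - t * (\<Sum>j<d. m j) \<le> (\<Sum>j<k. s j) - t * real k"
    by (simp add: algebra_simps sum_subtractf sum_distrib_left)
  moreover have "t * (\<Sum>j<d. m j) \<le> t * real k" using assms(5) t0 by (rule mult_left_mono)
  ultimately show ?thesis by linarith
qed

lemma unitary_row_sq:
  assumes "unitary d W" "j < d"
  shows "(\<Sum>i<d. (cmod (W $$ (j,i)))\<^sup>2) = 1"
  using unitary_col_sq[OF unitary_adjoint[OF assms(1)] assms(2)] unitaryD(1)[OF assms(1)] assms(2)
  by (simp add: col_sq_def)

lemma partial_row_sq_le:
  assumes "k \<le> d"
  shows "(\<Sum>i<k. (cmod (W $$ (j,i)))\<^sup>2) \<le> (\<Sum>i<d. (cmod (W $$ (j,i)))\<^sup>2)"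
  using assms by (intro sum_mono2) auto

lemma quad_rdiag_diag:
  assumes "W \<in> carrier_mat d n" "i < n"
  shows "(adj W * rdiag d f * W) $$ (i,i) = complex_of_real (\<Sum>j<d. f j * (cmod (W $$ (j,i)))\<^sup>2)"
proof -
  have 1: "adj W * rdiag d f = mat n d (\<lambda>(i,j). adj W $$ (i,j) * complex_of_real (f j))"
    using assms by (intro mat_diag_mult_right) auto
  have "(adj W * rdiag d f * W) $$ (i,i) = (\<Sum>j<d. (cnj (W $$ (j,i)) * complex_of_real (f j)) * W $$ (j,i))"
    using assms unfolding 1 by (simp add: mult_index[of _ n d _ n] del: index_mult_mat)
  also have "\<dots> = (\<Sum>j<d. complex_of_real (f j * (cmod (W $$ (j,i)))\<^sup>2))"
  proof (intro sum.cong refl)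
    fix j
    have "cnj (W $$ (j,i)) * W $$ (j,i) = complex_of_real ((cmod (W $$ (j,i)))\<^sup>2)"
      by (metis complex_norm_square mult.commute)
    then show "(cnj (W $$ (j,i)) * complex_of_real (f j)) * W $$ (j,i) = complex_of_real (f j * (cmod (W $$ (j,i)))\<^sup>2)"
      by (simp add: ac_simps)
  qed
  finally show ?thesis by simp
qed

text \<open>Ky Fan's maximum principle. In the eigenbasis, \<open>f j\<close> is weighted by a
  partial row sum of squared moduli of the unitary \<open>W\<close>: rows of length 1 bound each
  weight by 1, and columns of length 1 give total mass \<open>k\<close>.\<close>

lemma ky_fan_hermitian:
  assumes U: "unitary d U" and V: "unitary d V" and H: "H = V * rdiag d f * adj V"
    and f: "\<And>i. i < d \<Longrightarrow> 0 \<le> f i" "\<And>i j. i \<le> j \<Longrightarrow> j < d \<Longrightarrow> f j \<le> f i"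
    and k: "k \<le> d"
  shows "(\<Sum>i<k. Re ((adj U * H * U) $$ (i,i))) \<le> (\<Sum>i<k. f i)"
proof -
  note U' = unitaryD[OF U] and V' = unitaryD[OF V]
  define W where "W = adj V * U"
  have W: "unitary d W" unfolding W_def by (rule unitary_mult[OF unitary_adjoint[OF V] U])
  note W' = unitaryD[OF W]
  have eq: "adj U * H * U = adj W * rdiag d f * W"
    unfolding H W_def using U' V' by (simp add: adj_mult[of _ d d _ d] assoc_mult_mat[of _ d d _ d _ d])
  have "(\<Sum>i<k. Re ((adj U * H * U) $$ (i,i))) = (\<Sum>i<k. \<Sum>j<d. f j * (cmod (W $$ (j,i)))\<^sup>2)"
    unfolding eq using quad_rdiag_diag[OF W'(1)] k by (intro sum.cong) auto
  also have "\<dots> = (\<Sum>j<d. f j * (\<Sum>i<k. (cmod (W $$ (j,i)))\<^sup>2))"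
    unfolding sum_distrib_left by (rule sum.swap)
  also have "\<dots> \<le> (\<Sum>i<k. f i)"
  proof (rule weighted_sum_le_top_sum[OF f])
    show "0 \<le> (\<Sum>i<k. (cmod (W $$ (j,i)))\<^sup>2)" for j by (intro sum_nonneg) auto
    show "(\<Sum>i<k. (cmod (W $$ (j,i)))\<^sup>2) \<le> 1" if "j < d" for j
      using partial_row_sq_le[OF k, of W j] unitary_row_sq[OF W that] by simp
    have "(\<Sum>j<d. \<Sum>i<k. (cmod (W $$ (j,i)))\<^sup>2) = (\<Sum>i<k. col_sq W i)"
      unfolding col_sq_def using W'(1) by (subst sum.swap) auto
    also have "\<dots> = real k" using unitary_col_sq[OF W] k by simp
    finally show "(\<Sum>j<d. \<Sum>i<k. (cmod (W $$ (j,i)))\<^sup>2) \<le> real k" by simp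
  qed (use k in auto)
  finally show ?thesis .
qed

text \<open>\<open>Q * adj Q\<close> is an orthogonal projection. Its diagonal entry
  \<open>p\<close> is also the squared length of its column, which contains \<open>p\<close>, so
  \<open>p\<^sup>2 \<le> p\<close>.\<close>

lemma partial_isometry_row_sq_le:
  assumes Q: "Q \<in> carrier_mat d d" and QQ: "Q * (adj Q * Q) = Q" and i: "i < d"
  shows "col_sq (adj Q) i \<le> 1"
proof -
  define P where "P = Q * adj Q"
  have P: "P \<in> carrier_mat d d" "adj P = P"
    using Q by (auto simp: P_def adj_mult[of _ d d _ d])
  have "P * P = Q * (adj Q * Q) * adj Q"
    unfolding P_def using Q by (simp add: assoc_mult_mat[of _ d d _ d _ d])
  then have PP: "P * P = P" unfolding QQ P_def .
  have 1: "P $$ (i,i) = complex_of_real (col_sq (adj Q) i)"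
    using gram_diag[of "adj Q" d d i] Q i by (simp add: P_def)
  have "P $$ (i,i) = complex_of_real (col_sq P i)"
    using gram_diag[OF P(1) i] by (simp add: P PP)
  with 1 have "col_sq (adj Q) i = col_sq P i" by simp
  also have "col_sq P i \<ge> (cmod (P $$ (i,i)))\<^sup>2"
    unfolding col_sq_def using P(1) i by (intro member_le_sum) auto
  finally have "(col_sq (adj Q) i)\<^sup>2 \<le> col_sq (adj Q) i" unfolding 1 by simp
  then show ?thesis by (smt (verit) power2_eq_square mult_le_cancel_left1 col_sq_nonneg mult_left_le_imp_le)
qed

lemma Re_mult_le: "Re (a * b) \<le> ((cmod a)\<^sup>2 + (cmod b)\<^sup>2) / 2"
proof -
  have "Re (a * b) \<le> cmod a * cmod b" using complex_Re_le_cmod[of "a * b"] by (simp add: norm_mult)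
  also have "\<dots> \<le> ((cmod a)\<^sup>2 + (cmod b)\<^sup>2) / 2"
    using sum_squares_bound[of "cmod a" "cmod b"] by simp
  finally show ?thesis .
qed

lemma Re_complex_of_real_mult: "Re (complex_of_real a * z) = a * Re z"
  by simp

text \<open>The version for arbitrary matrices. The diagonal of \<open>adj U * X * U\<close> expands
  into terms \<open>s j * (Q $$ (i,j) * W $$ (j,i))\<close> with \<open>Q\<close> a partial isometry
  and \<open>W\<close> unitary; splitting each product by the inequality of means leads back to
  \<open>weighted_sum_le_top_sum\<close>.\<close>

lemma ky_fan_singular:
  assumes X: "X \<in> carrier_mat d d" and U: "unitary d U" and V: "unitary d V"
    and XX: "adj X * X = V * rdiag d (\<lambda>i. (s i)\<^sup>2) * adj V"
    and s: "\<And>i. i < d \<Longrightarrow> 0 \<le> s i" "\<And>i j. i \<le> j \<Longrightarrow> j < d \<Longrightarrow> s j \<le> s i"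
    and k: "k \<le> d"
  shows "(\<Sum>i<k. Re ((adj U * X * U) $$ (i,i))) \<le> (\<Sum>i<k. s i)"
proof -
  note U' = unitaryD[OF U] and V' = unitaryD[OF V]
  define W where "W = adj V * U"
  have W: "unitary d W" unfolding W_def by (rule unitary_mult[OF unitary_adjoint[OF V] U])
  note W' = unitaryD[OF W]
  \<comment> \<open>\<open>L\<close> will have orthogonal columns of lengths \<open>s j\<close>,
    because \<open>V\<close> diagonalizes \<open>adj X * X\<close>.\<close>
  define L where "L = adj U * (X * V)"
  have L: "L \<in> carrier_mat d d" using X U' V' by (simp add: L_def)
  have "adj L * L = adj (X * V) * (U * (adj U * (X * V)))"
    unfolding L_def using X U' V' by (simp add: adj_mult[of _ d d _ d] assoc_mult_mat[of _ d d _ d _ d])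
  also have "\<dots> = adj (X * V) * (X * V)"
    using X V' by (subst unitary_cancel(2)[OF U]) auto
  also have "\<dots> = adj V * (adj X * X) * V"
    using X V' by (simp add: adj_mult[of _ d d _ d] assoc_mult_mat[of _ d d _ d _ d])
  also have "\<dots> = rdiag d (\<lambda>i. (s i)\<^sup>2)"
    unfolding XX by (rule unitary_conj(2)[OF V]) simp
  finally have LL: "adj L * L = rdiag d (\<lambda>i. (s i)\<^sup>2)" .
  have L0: "L $$ (i,j) = 0" if "i < d" "j < d" "s j = 0" for i j
  proof -
    have "col_sq L j = 0"
      using gram_diag[OF L that(2)] that by (simp add: LL mat_diag_def)
    then show ?thesis unfolding col_sq_def using L that by (simp add: sum_nonneg_eq_0_iff)
  qed
  \<comment> \<open>Normalizes the columns of \<open>L\<close>. Where \<open>s j = 0\<close> the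
    division yields 0, matching a null column of \<open>L\<close>; so \<open>L\<close> is recovered
    from \<open>Q\<close>, and \<open>adj Q * Q\<close> is a 0-1 diagonal matrix.\<close>
  define Q where "Q = L * rdiag d (\<lambda>j. 1 / s j)"
  have Q: "Q \<in> carrier_mat d d" using L by (simp add: Q_def)
  have Qij: "Q $$ (i,j) = L $$ (i,j) / complex_of_real (s j)" if "i < d" "j < d" for i j
    unfolding Q_def using that by (simp add: mat_diag_mult_right[OF L])
  have LQ: "L $$ (i,j) = complex_of_real (s j) * Q $$ (i,j)" if "i < d" "j < d" for i j
    using Qij[OF that] L0[OF that] by (cases "s j = 0") auto
  define e where "e j = (if s j = 0 then 0 else 1 :: real)" for j
  have "adj Q * Q = adj (rdiag d (\<lambda>j. 1 / s j)) * (adj L * L) * rdiag d (\<lambda>j. 1 / s j)"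
    unfolding Q_def using L by (simp add: adj_mult[of _ d d _ d] assoc_mult_mat[of _ d d _ d _ d])
  also have "\<dots> = rdiag d e"
    unfolding LL adjoint_rdiag mat_diag_diag
    by (rule arg_cong[where f = "mat_diag d"]) (auto simp: e_def power2_eq_square)
  finally have QQ: "adj Q * Q = rdiag d e" .
  have Qe: "Q * (adj Q * Q) = Q"
    unfolding QQ mat_diag_mult_right[OF Q] using Q
    by (intro eq_matI) (auto simp: e_def Qij)
  have eq: "adj U * X * U = L * W"
  proof -
    have "L * W = adj U * X * (V * (adj V * U))"
      unfolding L_def W_def using X U' V' by (simp add: assoc_mult_mat[of _ d d _ d _ d])
    then show ?thesis unfolding unitary_cancel(2)[OF V U'(1)] by simp
  qed
  \<comment> \<open>\<open>m j\<close> dominates the weight of \<open>s j\<close>. Column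
    \<open>j\<close> of \<open>Q\<close> and row \<open>j\<close> of \<open>W\<close> bound it by 1;
    for the total mass the order of summation is swapped, and rows of \<open>Q\<close> and columns
    of \<open>W\<close> are used instead.\<close>
  define m where "m j = (\<Sum>i<k. ((cmod (Q $$ (i,j)))\<^sup>2 + (cmod (W $$ (j,i)))\<^sup>2) / 2)" for j
  have "(\<Sum>i<k. Re ((adj U * X * U) $$ (i,i))) = (\<Sum>i<k. \<Sum>j<d. s j * Re (Q $$ (i,j) * W $$ (j,i)))"
  proof (intro sum.cong refl)
    fix i assume "i \<in> {..<k}"
    then have i: "i < d" using k by auto
    have "(adj U * X * U) $$ (i,i) = (\<Sum>j<d. complex_of_real (s j) * (Q $$ (i,j) * W $$ (j,i)))"
      unfolding eq mult_index[OF L W'(1) i i] using LQ[OF i] by (intro sum.cong) auto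
    then show "Re ((adj U * X * U) $$ (i,i)) = (\<Sum>j<d. s j * Re (Q $$ (i,j) * W $$ (j,i)))"
      by (simp only: Re_sum Re_complex_of_real_mult)
  qed
  also have "\<dots> \<le> (\<Sum>i<k. \<Sum>j<d. s j * (((cmod (Q $$ (i,j)))\<^sup>2 + (cmod (W $$ (j,i)))\<^sup>2) / 2))"
    by (intro sum_mono mult_left_mono Re_mult_le) (use s in auto)
  also have "\<dots> = (\<Sum>j<d. s j * m j)"
    unfolding m_def sum_distrib_left by (rule sum.swap)
  also have "\<dots> \<le> (\<Sum>i<k. s i)"
  proof (rule weighted_sum_le_top_sum[OF s])
    show "0 \<le> m j" for j unfolding m_def by (intro sum_nonneg) auto
    show "m j \<le> 1" if j: "j < d" for j
    proof -
      have "(\<Sum>i<k. (cmod (Q $$ (i,j)))\<^sup>2) \<le> col_sq Q j"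
        unfolding col_sq_def using Q k by (intro sum_mono2) auto
      also have "\<dots> \<le> 1"
        using gram_diag[OF Q j] j by (simp add: QQ mat_diag_def e_def split: if_splits)
      finally have "(\<Sum>i<k. (cmod (Q $$ (i,j)))\<^sup>2) \<le> 1" .
      moreover have "(\<Sum>i<k. (cmod (W $$ (j,i)))\<^sup>2) \<le> 1"
        using partial_row_sq_le[OF k, of W j] unitary_row_sq[OF W j] by simp
      ultimately show ?thesis by (simp add: m_def sum.distrib flip: sum_divide_distrib)
    qed
    have "(\<Sum>j<d. m j) = (\<Sum>i<k. \<Sum>j<d. ((cmod (Q $$ (i,j)))\<^sup>2 + (cmod (W $$ (j,i)))\<^sup>2) / 2)"
      unfolding m_def by (rule sum.swap)
    also have "\<dots> \<le> (\<Sum>i<k. 1)"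
    proof (rule sum_mono)
      fix i assume "i \<in> {..<k}"
      then have i: "i < d" using k by auto
      have "(\<Sum>j<d. (cmod (Q $$ (i,j)))\<^sup>2) \<le> 1"
        using partial_isometry_row_sq_le[OF Q Qe i] Q i by (simp add: col_sq_def)
      moreover have "(\<Sum>j<d. (cmod (W $$ (j,i)))\<^sup>2) = 1"
        using unitary_col_sq[OF W i] W'(1) by (simp add: col_sq_def)
      ultimately show "(\<Sum>j<d. ((cmod (Q $$ (i,j)))\<^sup>2 + (cmod (W $$ (j,i)))\<^sup>2) / 2) \<le> 1"
        by (simp add: sum.distrib flip: sum_divide_distrib)
    qed
    finally show "(\<Sum>j<d. m j) \<le> real k" by simp
  qed (use k in auto)
  finally show ?thesis .
qed

subsection \<open>Square roots and contractions\<close>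

text \<open>Roots of the eigenvalues in an eigenbasis. The commutation clause serves to make roots
  of commuting matrices commute.\<close>

lemma psd_mat_sqrt:
  assumes A: "psd_mat d A"
  obtains R where "R \<in> carrier_mat d d" "adj R = R" "R * R = A"
    "\<And>B. B \<in> carrier_mat d d \<Longrightarrow> A * B = B * A \<Longrightarrow> R * B = B * R"
proof -
  have Ac: "A \<in> carrier_mat d d" "adj A = A" using A by (auto simp: psd_mat_def)
  obtain U f where U: "unitary d U" and AU: "A = U * rdiag d f * adj U"
    using hermitian_spectral[OF Ac, of "\<lambda>x. x"] by metis
  note U' = unitaryD[OF U]
  have D: "adj U * A * U = rdiag d f" unfolding AU by (rule unitary_conj(2)[OF U]) simp
  \<comment> \<open>\<open>f i\<close> is the quadratic form of \<open>A\<close> at the eigenvector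
    \<open>col U i\<close>.\<close>
  have f: "0 \<le> f i" if i: "i < d" for i
  proof -
    have "(adj U * A * U) $$ (i,i) = (adj U * (A * U)) $$ (i,i)"
      using U' Ac by (simp add: assoc_mult_mat[of _ d d _ d _ d])
    also have "\<dots> = row (adj U) i \<bullet> col (A * U) i" using U' Ac i by simp
    also have "row (adj U) i = conjugate (col U i)" using U' i by (intro eq_vecI) auto
    also have "col (A * U) i = A *\<^sub>v col U i" using U' Ac i by (intro col_mult2[of _ d d _ d]) auto
    finally have "complex_of_real (f i) = conjugate (col U i) \<bullet> (A *\<^sub>v col U i)"
      unfolding D using i by (simp add: mat_diag_def)
    then have "f i = Re (conjugate (col U i) \<bullet> (A *\<^sub>v col U i))"
      by (metis Re_complex_of_real)
    moreover have "col U i \<in> carrier_vec d" using U'(1) col_dim[of U i] by simp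
    ultimately show ?thesis using A by (simp add: psd_mat_def)
  qed
  define E where "E = rdiag d (\<lambda>i. sqrt (f i))"
  have E: "E \<in> carrier_mat d d" "adj E = E" by (simp_all add: E_def)
  have EE: "E * E = rdiag d f"
    unfolding E_def mat_diag_diag using f by (intro eq_matI) (auto simp: mat_diag_def simp flip: of_real_mult)
  define R where "R = U * E * adj U"
  have R: "R \<in> carrier_mat d d" using U' E by (simp add: R_def)
  have "adj R = R" unfolding R_def using U' E
    by (simp add: adj_mult[of _ d d _ d] assoc_mult_mat[of _ d d _ d _ d])
  moreover have "R * R = A"
    unfolding R_def unitary_conj_mult[OF U E(1) E(1)] EE AU ..
  moreover have "R * B = B * R" if B: "B \<in> carrier_mat d d" and AB: "A * B = B * A" for B
  proof -
    define B' where "B' = adj U * B * U"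
    have B': "B' \<in> carrier_mat d d" using U' B by (simp add: B'_def)
    have BU: "B = U * B' * adj U" unfolding B'_def by (rule unitary_conj(1)[OF U B, symmetric])
    have "U * (rdiag d f * B') * adj U = U * (B' * rdiag d f) * adj U"
      using AB unfolding AU BU using B' by (simp add: unitary_conj_mult[OF U])
    then have "adj U * (U * (rdiag d f * B') * adj U) * U = adj U * (U * (B' * rdiag d f) * adj U) * U"
      by simp
    then have eq: "rdiag d f * B' = B' * rdiag d f"
      using B' by (simp add: unitary_conj(2)[OF U])
    \<comment> \<open>Commuting with \<open>rdiag d f\<close> forces \<open>B'\<close> to vanish
      between distinct eigenvalues, and equal eigenvalues have equal roots.\<close>
    have "E * B' = B' * E"
    proof (rule eq_matI)
      fix i j assume "i < dim_row (B' * E)" "j < dim_col (B' * E)"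
      then have ij: "i < d" "j < d" using B' E by auto
      have "complex_of_real (f i) * B' $$ (i,j) = B' $$ (i,j) * complex_of_real (f j)"
        using arg_cong[OF eq, of "\<lambda>M. M $$ (i,j)"] ij
        by (simp add: mat_diag_mult_left[OF B'] mat_diag_mult_right[OF B'] del: index_mult_mat)
      then have "B' $$ (i,j) = 0 \<or> f i = f j" by auto
      then show "(E * B') $$ (i,j) = (B' * E) $$ (i,j)" unfolding E_def using ij
        by (auto simp add: mat_diag_mult_left[OF B'] mat_diag_mult_right[OF B'] simp del: index_mult_mat)
    qed (use B' E in auto)
    then show ?thesis unfolding R_def BU using E B' by (simp add: unitary_conj_mult[OF U])
  qed
  ultimately show thesis using that[OF R] by blast
qed

section \<open>Finite matrix sums and contractive rows\<close>

lemma msum_carrier [simp]: "msum d K F \<in> carrier_mat d d"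
  by (simp add: msum_def)

lemma msum_index: "i < d \<Longrightarrow> j < d \<Longrightarrow> msum d K F $$ (i,j) = (\<Sum>k=1..K. F k $$ (i,j))"
  by (simp add: msum_def)

lemma msum_cong: "(\<And>k. k \<in> {1..K} \<Longrightarrow> F k = G k) \<Longrightarrow> msum d K F = msum d K G"
  by (auto simp: msum_def intro!: eq_matI sum.cong)

lemma mult_msum_left:
  assumes Z: "Z \<in> carrier_mat d d" and F: "\<And>k. k \<in> {1..K} \<Longrightarrow> F k \<in> carrier_mat d d"
  shows "Z * msum d K F = msum d K (\<lambda>k. Z * F k)"
proof (rule eq_matI)
  fix i j assume "i < dim_row (msum d K (\<lambda>k. Z * F k))" "j < dim_col (msum d K (\<lambda>k. Z * F k))"
  then have ij: "i < d" "j < d" by (auto simp: msum_def)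
  have "(Z * msum d K F) $$ (i,j) = (\<Sum>l<d. \<Sum>k=1..K. Z $$ (i,l) * F k $$ (l,j))"
    unfolding mult_index[OF Z msum_carrier ij] using ij
    by (intro sum.cong) (auto simp: msum_index sum_distrib_left)
  also have "\<dots> = (\<Sum>k=1..K. \<Sum>l<d. Z $$ (i,l) * F k $$ (l,j))" by (rule sum.swap)
  also have "\<dots> = (\<Sum>k=1..K. (Z * F k) $$ (i,j))"
    by (intro sum.cong refl) (rule mult_index[OF Z F ij, symmetric])
  finally show "(Z * msum d K F) $$ (i,j) = msum d K (\<lambda>k. Z * F k) $$ (i,j)"
    using ij by (simp add: msum_index)
qed (use Z in \<open>auto simp: msum_def\<close>)

lemma mult_msum_right:
  assumes Z: "Z \<in> carrier_mat d d" and F: "\<And>k. k \<in> {1..K} \<Longrightarrow> F k \<in> carrier_mat d d"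
  shows "msum d K F * Z = msum d K (\<lambda>k. F k * Z)"
proof (rule eq_matI)
  fix i j assume "i < dim_row (msum d K (\<lambda>k. F k * Z))" "j < dim_col (msum d K (\<lambda>k. F k * Z))"
  then have ij: "i < d" "j < d" by (auto simp: msum_def)
  have "(msum d K F * Z) $$ (i,j) = (\<Sum>l<d. \<Sum>k=1..K. F k $$ (i,l) * Z $$ (l,j))"
    unfolding mult_index[OF msum_carrier Z ij] using ij
    by (intro sum.cong) (auto simp: msum_index sum_distrib_right)
  also have "\<dots> = (\<Sum>k=1..K. \<Sum>l<d. F k $$ (i,l) * Z $$ (l,j))" by (rule sum.swap)
  also have "\<dots> = (\<Sum>k=1..K. (F k * Z) $$ (i,j))"
    by (intro sum.cong refl) (rule mult_index[OF F Z ij, symmetric])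
  finally show "(msum d K F * Z) $$ (i,j) = msum d K (\<lambda>k. F k * Z) $$ (i,j)"
    using ij by (simp add: msum_index)
qed (use Z in \<open>auto simp: msum_def\<close>)

lemma adj_msum:
  assumes "\<And>k. k \<in> {1..K} \<Longrightarrow> F k \<in> carrier_mat d d"
  shows "adj (msum d K F) = msum d K (\<lambda>k. adj (F k))"
proof (rule eq_matI)
  fix i j assume "i < dim_row (msum d K (\<lambda>k. adj (F k)))" "j < dim_col (msum d K (\<lambda>k. adj (F k)))"
  then have ij: "i < d" "j < d" by (auto simp: msum_def)
  have "adj (msum d K F) $$ (i,j) = cnj (msum d K F $$ (j,i))"
    using ij by (intro adj_index) (auto simp: msum_def)
  also have "\<dots> = (\<Sum>k=1..K. cnj (F k $$ (j,i)))" using ij by (simp add: msum_index)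
  also have "\<dots> = (\<Sum>k=1..K. adj (F k) $$ (i,j))"
    using ij assms by (intro sum.cong refl adj_index[symmetric]) fastforce+
  finally show "adj (msum d K F) $$ (i,j) = msum d K (\<lambda>k. adj (F k)) $$ (i,j)"
    using ij by (simp add: msum_index)
qed (auto simp: msum_def)

text \<open>The conjugated sum is a sum of Gram matrices. When \<open>Z\<close> is an eigenbasis the
  entry is an eigenvalue, which is thus nonnegative and vanishes only if every summand does.\<close>

lemma msum_gram_diag:
  assumes P: "\<And>k. k \<in> {1..K} \<Longrightarrow> P k \<in> carrier_mat d d" and Z: "Z \<in> carrier_mat d d" and i: "i < d"
  shows "(adj Z * msum d K (\<lambda>k. P k * adj (P k)) * Z) $$ (i,i) =
    complex_of_real (\<Sum>k=1..K. col_sq (adj (P k) * Z) i)"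
proof -
  have "adj Z * msum d K (\<lambda>k. P k * adj (P k)) * Z = msum d K (\<lambda>k. adj Z * (P k * adj (P k)) * Z)"
    using P Z by (subst mult_msum_left, simp_all, subst mult_msum_right, simp_all)
  also have "\<dots> = msum d K (\<lambda>k. adj (adj (P k) * Z) * (adj (P k) * Z))"
    using P Z by (intro msum_cong) (simp add: adj_mult[of _ d d _ d] assoc_mult_mat[of _ d d _ d _ d])
  finally have eq: "adj Z * msum d K (\<lambda>k. P k * adj (P k)) * Z = msum d K (\<lambda>k. adj (adj (P k) * Z) * (adj (P k) * Z))" .
  have "(adj (adj (P k) * Z) * (adj (P k) * Z)) $$ (i,i) = complex_of_real (col_sq (adj (P k) * Z) i)"
    if "k \<in> {1..K}" for k
    using P[OF that] Z i by (intro gram_diag[of _ d d]) auto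
  then show ?thesis unfolding eq using i by (simp add: msum_index)
qed

text \<open>If the row \<open>(P\<^sub>1, \<dots>, P\<^sub>K)\<close> has Gram matrix \<open>S\<^sup>2\<close>, polar decomposition
  writes it as \<open>S\<close> times a contractive row. The pseudo-inverse of \<open>S\<close> is diagonal with entries
  \<open>1 / sqrt (f i)\<close>, relying on \<open>1 / 0 = 0\<close>.\<close>

lemma row_polar_decomposition:
  assumes P: "\<And>k. k \<in> {1..K} \<Longrightarrow> P k \<in> carrier_mat d d"
  obtains S G where "S \<in> carrier_mat d d" "adj S = S" "S * S = msum d K (\<lambda>k. P k * adj (P k))"
    "\<And>k. k \<in> {1..K} \<Longrightarrow> G k \<in> carrier_mat d d" "\<And>k. k \<in> {1..K} \<Longrightarrow> P k = S * G k"
    "\<And>W i. W \<in> carrier_mat d d \<Longrightarrow> i < d \<Longrightarrow> (\<Sum>k=1..K. col_sq (adj (G k) * W) i) \<le> col_sq W i"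
proof -
  define A where "A = msum d K (\<lambda>k. P k * adj (P k))"
  have A: "A \<in> carrier_mat d d" by (simp add: A_def)
  have "adj A = A"
    unfolding A_def using P by (subst adj_msum) (auto intro!: msum_cong simp: adj_mult[of _ d d _ d])
  then obtain U f where U: "unitary d U" and AU: "A = U * rdiag d f * adj U"
    using hermitian_spectral[OF A, of "\<lambda>x. x"] by metis
  note U' = unitaryD[OF U]
  have D: "adj U * A * U = rdiag d f" unfolding AU by (rule unitary_conj(2)[OF U]) simp
  have fP: "f i = (\<Sum>k=1..K. col_sq (adj (P k) * U) i)" if "i < d" for i
  proof -
    have "complex_of_real (f i) = (adj U * A * U) $$ (i,i)"
      unfolding D using that by (simp add: mat_diag_def)
    also have "\<dots> = complex_of_real (\<Sum>k=1..K. col_sq (adj (P k) * U) i)"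
      unfolding A_def by (rule msum_gram_diag[OF P U'(1) that])
    finally have "complex_of_real (f i) = complex_of_real (\<Sum>k=1..K. col_sq (adj (P k) * U) i)" .
    then show ?thesis by (simp only: of_real_eq_iff)
  qed
  have f: "0 \<le> f i" if "i < d" for i unfolding fP[OF that] by (intro sum_nonneg) simp
  define E where "E = rdiag d (\<lambda>i. sqrt (f i))"
  define I where "I = rdiag d (\<lambda>i. 1 / sqrt (f i))"
  have E: "E \<in> carrier_mat d d" "adj E = E" and I: "I \<in> carrier_mat d d" "adj I = I"
    by (simp_all add: E_def I_def del: of_real_divide)
  have EE: "E * E = rdiag d f"
    unfolding E_def mat_diag_diag using f by (intro eq_matI) (auto simp: mat_diag_def simp flip: of_real_mult)
  define S where "S = U * E * adj U"
  define G where "G k = U * (I * (adj U * P k))" for k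
  have S: "S \<in> carrier_mat d d" using U' E by (simp add: S_def)
  have "adj S = S" unfolding S_def using U' E
    by (simp add: adj_mult[of _ d d _ d] assoc_mult_mat[of _ d d _ d _ d])
  moreover have "S * S = A"
    unfolding S_def unitary_conj_mult[OF U E(1) E(1)] EE AU ..
  moreover have "G k \<in> carrier_mat d d" if "k \<in> {1..K}" for k
    using P[OF that] U' I by (simp add: G_def)
  moreover have "P k = S * G k" if k: "k \<in> {1..K}" for k
  proof -
    define H where "H = adj U * P k"
    have H: "H \<in> carrier_mat d d" using P[OF k] U' by (simp add: H_def)
    have "S * G k = U * E * (adj U * (U * (I * H)))"
      unfolding S_def G_def H_def using U' E I P[OF k] by (simp add: assoc_mult_mat[of _ d d _ d _ d])
    also have "\<dots> = U * E * (I * H)"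
      using I H by (subst unitary_cancel(1)[OF U]) auto
    also have "\<dots> = U * (E * I * H)"
      using U' E I H by (simp add: assoc_mult_mat[of _ d d _ d _ d])
    also have "E * I * H = H"
    proof (rule eq_matI)
      fix i j assume "i < dim_row H" "j < dim_col H"
      then have ij: "i < d" "j < d" using H by auto
      \<comment> \<open>A zero eigenvalue makes every term of \<open>fP\<close> vanish, hence row
        \<open>i\<close> of \<open>H\<close>, so the pseudo-inverse loses nothing there.\<close>
      have "H $$ (i,j) = 0" if "f i = 0"
      proof -
        have "col_sq (adj (P k) * U) i = 0"
          using fP[OF ij(1)] that k by (simp add: sum_nonneg_eq_0_iff)
        moreover have "adj (P k) * U = adj H"
          unfolding H_def using P[OF k] U' by (simp add: adj_mult[of _ d d _ d])
        ultimately show ?thesis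
          using H ij by (simp add: col_sq_def sum_nonneg_eq_0_iff)
      qed
      then show "(E * I * H) $$ (i,j) = H $$ (i,j)"
        unfolding E_def I_def mat_diag_diag mat_diag_mult_left[OF H] using ij f[OF ij(1)] by auto
    qed (use E I H in auto)
    also have "U * H = P k" unfolding H_def using P[OF k] by (rule unitary_cancel(2)[OF U])
    finally show ?thesis by simp
  qed
  moreover have "(\<Sum>k=1..K. col_sq (adj (G k) * W) i) \<le> col_sq W i"
    if W: "W \<in> carrier_mat d d" and i: "i < d" for W i
  proof -
    define W' where "W' = adj U * W"
    have W': "W' \<in> carrier_mat d d" using U' W by (simp add: W'_def)
    \<comment> \<open>Shifting the pseudo-inverse from \<open>G k\<close> onto \<open>W\<close>
      turns the sum into a diagonal entry of \<open>adj Z * A * Z\<close>. There \<open>I\<close>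
      cancels the nonzero eigenvalues and leaves the support projection \<open>rdiag d e\<close>,
      which shortens columns.\<close>
    define Z where "Z = U * (I * W')"
    have Z: "Z \<in> carrier_mat d d" using U' I W' by (simp add: Z_def)
    define e where "e i = (if f i = 0 then 0 else 1 :: real)" for i
    have GW: "adj (G k) * W = adj (P k) * Z" if "k \<in> {1..K}" for k
      unfolding G_def Z_def W'_def using P[OF that] U' I W
      by (simp add: adj_mult[of _ d d _ d] assoc_mult_mat[of _ d d _ d _ d])
    have "adj Z * A * Z = adj W' * (I * (adj U * A * U) * I) * W'"
      unfolding Z_def using U' I W' A by (simp add: adj_mult[of _ d d _ d] assoc_mult_mat[of _ d d _ d _ d])
    also have "I * (adj U * A * U) * I = rdiag d e"
      unfolding D I_def mat_diag_diag using f
      by (intro eq_matI) (auto simp: mat_diag_def e_def simp flip: of_real_mult of_real_divide)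
    finally have "(adj Z * A * Z) $$ (i,i) = complex_of_real (\<Sum>j<d. e j * (cmod (W' $$ (j,i)))\<^sup>2)"
      using quad_rdiag_diag[OF W' i] by simp
    moreover have "(adj Z * A * Z) $$ (i,i) = complex_of_real (\<Sum>k=1..K. col_sq (adj (P k) * Z) i)"
      unfolding A_def by (rule msum_gram_diag[OF P Z i])
    ultimately have "(\<Sum>k=1..K. col_sq (adj (P k) * Z) i) = (\<Sum>j<d. e j * (cmod (W' $$ (j,i)))\<^sup>2)"
      by (metis of_real_eq_iff)
    also have "\<dots> \<le> col_sq W' i"
      unfolding col_sq_def using W' by (auto intro!: sum_mono simp: e_def)
    also have "\<dots> = col_sq W i"
      unfolding W'_def by (rule col_sq_unitary[OF unitary_adjoint[OF U] W i])
    finally show ?thesis using GW by simp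
  qed
  ultimately show thesis using that[OF S] unfolding A_def by blast
qed

lemma Re_gram_le:
  assumes "X \<in> carrier_mat n m" "Y \<in> carrier_mat n m" "i < m"
  shows "Re ((adj X * Y) $$ (i,i)) \<le> (col_sq X i + col_sq Y i) / 2"
proof -
  have "Re ((adj X * Y) $$ (i,i)) = (\<Sum>l<n. Re (cnj (X $$ (l,i)) * Y $$ (l,i)))"
    using assms by (simp add: mult_index[of _ m n _ m] del: index_mult_mat times_complex.sel)
  also have "\<dots> \<le> (\<Sum>l<n. ((cmod (X $$ (l,i)))\<^sup>2 + (cmod (Y $$ (l,i)))\<^sup>2) / 2)"
    using Re_mult_le[of "cnj (X $$ (l,i))" "Y $$ (l,i)" for l] by (intro sum_mono) simp
  also have "\<dots> = (col_sq X i + col_sq Y i) / 2"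
    using assms by (simp add: col_sq_def sum.distrib flip: sum_divide_distrib)
  finally show ?thesis .
qed

text \<open>Let \<open>E\<close> be the product. Its squared column length is a sum of inner
  products of columns of \<open>adj (G k) * E\<close> and \<open>adj (H k) * W\<close>. The
  inequality of means and both contraction bounds give at most half of
  \<open>col_sq E i + col_sq W i\<close>, and the term in \<open>E\<close> is absorbed on the
  left.\<close>

lemma contractive_rows_product:
  assumes G: "\<And>k. k \<in> {1..K} \<Longrightarrow> G k \<in> carrier_mat d d" and H: "\<And>k. k \<in> {1..K} \<Longrightarrow> H k \<in> carrier_mat d d"
    and cG: "\<And>W i. W \<in> carrier_mat d d \<Longrightarrow> i < d \<Longrightarrow> (\<Sum>k=1..K. col_sq (adj (G k) * W) i) \<le> col_sq W i"
    and cH: "\<And>W i. W \<in> carrier_mat d d \<Longrightarrow> i < d \<Longrightarrow> (\<Sum>k=1..K. col_sq (adj (H k) * W) i) \<le> col_sq W i"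
    and W: "W \<in> carrier_mat d d" and i: "i < d"
  shows "col_sq (msum d K (\<lambda>k. G k * adj (H k)) * W) i \<le> col_sq W i"
proof -
  define E where "E = msum d K (\<lambda>k. G k * adj (H k)) * W"
  have E: "E \<in> carrier_mat d d" using W by (simp add: E_def)
  have "adj E * E = msum d K (\<lambda>k. adj E * (G k * adj (H k) * W))"
  proof -
    have "E = msum d K (\<lambda>k. G k * adj (H k) * W)"
      unfolding E_def using G H W by (intro mult_msum_right) simp_all
    then have "adj E * E = adj E * msum d K (\<lambda>k. G k * adj (H k) * W)" by simp
    also have "\<dots> = msum d K (\<lambda>k. adj E * (G k * adj (H k) * W))"
      using G H W E by (intro mult_msum_left) simp_all
    finally show ?thesis .
  qed
  also have "\<dots> = msum d K (\<lambda>k. adj (adj (G k) * E) * (adj (H k) * W))"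
    using G H E W by (intro msum_cong) (simp add: adj_mult[of _ d d _ d] assoc_mult_mat[of _ d d _ d _ d])
  finally have "col_sq E i = Re (msum d K (\<lambda>k. adj (adj (G k) * E) * (adj (H k) * W)) $$ (i,i))"
    using gram_diag[OF E i] by simp
  also have "\<dots> = (\<Sum>k=1..K. Re ((adj (adj (G k) * E) * (adj (H k) * W)) $$ (i,i)))"
    unfolding msum_index[OF i i] by (rule Re_sum)
  also have "\<dots> \<le> (\<Sum>k=1..K. (col_sq (adj (G k) * E) i + col_sq (adj (H k) * W) i) / 2)"
    using G H E W i by (intro sum_mono Re_gram_le[of _ d d]) auto
  also have "\<dots> \<le> (col_sq E i + col_sq W i) / 2"
    using cG[OF E i] cH[OF W i] by (simp add: sum.distrib flip: sum_divide_distrib)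
  finally show ?thesis unfolding E_def by simp
qed

section \<open>Choice of signs by the parallelogram law\<close>

lemma parallelogram_choice:
  fixes N :: "real \<Rightarrow> real"
  assumes "N 1 + N (- 1) = 2 * (a + b)"
  obtains c where "c = 1 \<or> c = - 1" "a + b \<le> N c"
  using assms by (cases "a + b \<le> N 1") fastforce+

text \<open>The left-hand side is the average of the right-hand side over all sign patterns \<open>w\<close>; the
  signs are chosen one at a time with the parallelogram law.\<close>

lemma sign_choice:
  assumes V: "V \<in> carrier_mat d d" and k: "k \<le> d"
    and X: "\<And>j. j \<in> {1..K} \<Longrightarrow> X j \<in> carrier_mat d d"
  shows "\<exists>w. (\<forall>j. w j = 1 \<or> w j = - 1) \<and>
    (\<Sum>j=1..K. \<Sum>i<k. col_sq (X j * V) i) \<le>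
    (\<Sum>i<k. col_sq (msum d K (\<lambda>j. complex_of_real (w j) \<cdot>\<^sub>m X j) * V) i)"
  using X
proof (induction K)
  case 0
  show ?case by (intro exI[of _ "\<lambda>_. 1"]) (auto intro!: sum_nonneg)
next
  case (Suc K)
  from Suc.IH Suc.prems obtain w where w: "\<And>j. w j = 1 \<or> w j = - 1" and
    le: "(\<Sum>j=1..K. \<Sum>i<k. col_sq (X j * V) i) \<le>
    (\<Sum>i<k. col_sq (msum d K (\<lambda>j. complex_of_real (w j) \<cdot>\<^sub>m X j) * V) i)"
    by fastforce
  define G where "G = msum d K (\<lambda>j. complex_of_real (w j) \<cdot>\<^sub>m X j) * V"
  define Y where "Y = X (Suc K) * V"
  have G: "G \<in> carrier_mat d d" and Y: "Y \<in> carrier_mat d d"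
    using V Suc.prems by (auto simp: G_def Y_def)
  \<comment> \<open>\<open>N c\<close> is the squared length of the frame once the new term is added
    with sign \<open>c\<close>. The mixed terms cancel between the two signs, so one sign does at
    least as well as having no mixed terms.\<close>
  define N where "N c = (\<Sum>i<k. \<Sum>l<d. (cmod (G $$ (l,i) + complex_of_real c * Y $$ (l,i)))\<^sup>2)" for c
  have par: "(cmod (x + y))\<^sup>2 + (cmod (x - y))\<^sup>2 = 2 * ((cmod x)\<^sup>2 + (cmod y)\<^sup>2)" for x y :: complex
    unfolding cmod_power2 by (simp add: power2_eq_square algebra_simps)
  have "N 1 + N (- 1) = (\<Sum>i<k. \<Sum>l<d. (cmod (G $$ (l,i) + Y $$ (l,i)))\<^sup>2 + (cmod (G $$ (l,i) - Y $$ (l,i)))\<^sup>2)"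
    by (simp add: N_def sum.distrib)
  also have "\<dots> = 2 * ((\<Sum>i<k. col_sq G i) + (\<Sum>i<k. col_sq Y i))"
    using G Y by (simp add: par col_sq_def sum.distrib sum_distrib_left)
  finally obtain c where c: "c = 1 \<or> c = - 1" and cN: "(\<Sum>i<k. col_sq G i) + (\<Sum>i<k. col_sq Y i) \<le> N c"
    by (rule parallelogram_choice)
  define w' where "w' = w(Suc K := c)"
  have M: "msum d (Suc K) (\<lambda>j. complex_of_real (w' j) \<cdot>\<^sub>m X j) * V = G + complex_of_real c \<cdot>\<^sub>m Y"
  proof -
    have "msum d (Suc K) (\<lambda>j. complex_of_real (w' j) \<cdot>\<^sub>m X j) =
      msum d K (\<lambda>j. complex_of_real (w j) \<cdot>\<^sub>m X j) + complex_of_real c \<cdot>\<^sub>m X (Suc K)"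
      using Suc.prems[of "Suc K"] by (intro eq_matI) (auto simp: msum_def w'_def intro!: sum.cong)
    then show ?thesis
      unfolding G_def Y_def using Suc.prems V
      by (simp add: add_mult_distrib_mat[of _ d d _ _ d] mult_smult_assoc_mat[of _ d d _ d])
  qed
  have "N c = (\<Sum>i<k. col_sq (G + complex_of_real c \<cdot>\<^sub>m Y) i)"
    unfolding N_def col_sq_def using G Y k by (intro sum.cong) auto
  then have "(\<Sum>j=1..Suc K. \<Sum>i<k. col_sq (X j * V) i) \<le>
    (\<Sum>i<k. col_sq (msum d (Suc K) (\<lambda>j. complex_of_real (w' j) \<cdot>\<^sub>m X j) * V) i)"
    using le cN unfolding M by (simp add: G_def Y_def)
  moreover have "\<forall>j. w' j = 1 \<or> w' j = - 1" using w c by (simp add: w'_def)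
  ultimately show ?case by blast
qed

subsection \<open>The majorization\<close>

text \<open>The commutation clause is applied twice: the root of \<open>A\<close> commutes with
  \<open>B\<close>, and therefore with the root of \<open>B\<close>.\<close>

lemma commuting_psd_roots:
  assumes A: "psd_mat d A" and B: "psd_mat d B" and AB: "A * B = B * A"
  shows "\<exists>R Q. R \<in> carrier_mat d d \<and> Q \<in> carrier_mat d d \<and> adj R = R \<and> adj Q = Q \<and>
    R * R = A \<and> Q * Q = B \<and> R * Q = Q * R"
proof -
  have Bc: "B \<in> carrier_mat d d" using B by (simp add: psd_mat_def)
  obtain R where R: "R \<in> carrier_mat d d" "adj R = R" "R * R = A"
    and cR: "\<And>C. C \<in> carrier_mat d d \<Longrightarrow> A * C = C * A \<Longrightarrow> R * C = C * R"
    using psd_mat_sqrt[OF A] by metis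
  obtain Q where Q: "Q \<in> carrier_mat d d" "adj Q = Q" "Q * Q = B"
    and cQ: "\<And>C. C \<in> carrier_mat d d \<Longrightarrow> B * C = C * B \<Longrightarrow> Q * C = C * Q"
    using psd_mat_sqrt[OF B] by metis
  have "R * Q = Q * R" using cQ[OF R(1)] cR[OF Bc AB] by simp
  with R Q show ?thesis by blast
qed

text \<open>A triangularizing basis with the eigenvalues in the listed order. Each eigenvalue is one
  entry in a column of \<open>T\<close>, so its square is at most the squared length of that column,
  and \<open>T\<close> differs from \<open>A * W\<close> only by a unitary factor on the
  left.\<close>

lemma schur_basis:
  assumes A: "A \<in> carrier_mat d d"
    and cp: "char_poly A = (\<Prod>i\<leftarrow>[0..<d]. [:- complex_of_real (f i), 1:])"
  obtains W where "unitary d W" "\<And>i. i < d \<Longrightarrow> (adj W * A * W) $$ (i,i) = complex_of_real (f i)"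
    "\<And>i. i < d \<Longrightarrow> (f i)\<^sup>2 \<le> col_sq (A * W) i"
proof -
  have "char_poly A = (\<Prod>e\<leftarrow>map (\<lambda>i. complex_of_real (f i)) [0..<d]. [:- e, 1:])"
    unfolding cp by (simp add: comp_def)
  from unitary_schur[OF A this] obtain W T where W: "unitary d W" and T: "T \<in> carrier_mat d d"
    and dT: "diag_mat T = map (\<lambda>i. complex_of_real (f i)) [0..<d]" and AW: "A = W * T * adj W"
    by blast
  note W' = unitaryD[OF W]
  have T_eq: "adj W * A * W = T" unfolding AW by (rule unitary_conj(2)[OF W T])
  have Tii: "T $$ (i,i) = complex_of_real (f i)" if "i < d" for i
    using arg_cong[OF dT, of "\<lambda>xs. xs ! i"] that T by (simp add: diag_mat_def)
  have "(f i)\<^sup>2 \<le> col_sq (A * W) i" if i: "i < d" for i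
  proof -
    have "(f i)\<^sup>2 = (cmod (T $$ (i,i)))\<^sup>2" by (simp add: Tii[OF i])
    also have "\<dots> \<le> col_sq T i" unfolding col_sq_def using T i by (intro member_le_sum) auto
    also have "T = adj W * (A * W)"
      unfolding T_eq[symmetric] using W' A by (simp add: assoc_mult_mat[of _ d d _ d _ d])
    also have "col_sq \<dots> i = col_sq (A * W) i"
      using W' A i by (intro col_sq_unitary[OF unitary_adjoint[OF W]]) auto
    finally show ?thesis .
  qed
  then show thesis using that[OF W] Tii unfolding T_eq by blast
qed

text \<open>The enumerations are already decreasing, so the sorting inside \<open>weak_maj\<close>
  changes nothing.\<close>

lemma weak_maj_map:
  assumes x: "\<And>i j. i \<le> j \<Longrightarrow> j < d \<Longrightarrow> x j \<le> x i" and y: "\<And>i j. i \<le> j \<Longrightarrow> j < d \<Longrightarrow> y j \<le> y i"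
    and le: "\<And>k. k \<le> d \<Longrightarrow> (\<Sum>i<k. x i) \<le> (\<Sum>i<k. y i)"
  shows "weak_maj (map x [0..<d]) (map y [0..<d])"
proof -
  have top: "sum_list (take k (rev (sort (map z [0..<d])))) = (\<Sum>i<k. z i)"
    if z: "\<And>i j. i \<le> j \<Longrightarrow> j < d \<Longrightarrow> z j \<le> z i" and k: "k \<le> d" for z :: "nat \<Rightarrow> real" and k
  proof -
    have "sorted_wrt (\<ge>) (rev (sort (map z [0..<d])))"
      by (simp add: sorted_wrt_rev)
    moreover have "sorted_wrt (\<ge>) (map z [0..<d])"
      using z by (auto simp: sorted_wrt_iff_nth_less)
    ultimately have "rev (sort (map z [0..<d])) = map z [0..<d]"
      by (rule sorted_ge_mset_unique) simp
    then have "take k (rev (sort (map z [0..<d]))) = map z [0..<k]"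
      using k by (simp add: take_map)
    then show ?thesis by (simp add: interv_sum_list_conv_sum_set_nat atLeast0LessThan)
  qed
  show ?thesis using le by (auto simp: weak_maj_def top[OF x] top[OF y])
qed

text \<open>The core estimate, for one choice of signs. The sum of the
  \<open>P j * adj (Q j)\<close> enters only through its characteristic polynomial, so factors can
  be moved cyclically, and \<open>m\<close> may list the eigenvalues in any order.\<close>

lemma sum_sq_eigenvalues_le:
  assumes P: "\<And>j. j \<in> {1..K} \<Longrightarrow> P j \<in> carrier_mat d d" and Q: "\<And>j. j \<in> {1..K} \<Longrightarrow> Q j \<in> carrier_mat d d"
    and cp: "char_poly (msum d K (\<lambda>j. P j * adj (Q j))) = (\<Prod>i\<leftarrow>[0..<d]. [:- complex_of_real (m i), 1:])"
    and T: "T = msum d K (\<lambda>j. P j * adj (P j)) * msum d K (\<lambda>j. Q j * adj (Q j))"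
    and V: "unitary d V" and TT: "adj T * T = V * rdiag d (\<lambda>i. (s i)\<^sup>2) * adj V"
    and s: "\<And>i. i < d \<Longrightarrow> 0 \<le> s i" "\<And>i j. i \<le> j \<Longrightarrow> j < d \<Longrightarrow> s j \<le> s i"
    and k: "k \<le> d"
  shows "(\<Sum>i<k. (m i)\<^sup>2) \<le> (\<Sum>i<k. s i)"
proof -
  obtain S G where S: "S \<in> carrier_mat d d" "adj S = S" "S * S = msum d K (\<lambda>j. P j * adj (P j))"
    and G: "\<And>j. j \<in> {1..K} \<Longrightarrow> G j \<in> carrier_mat d d" "\<And>j. j \<in> {1..K} \<Longrightarrow> P j = S * G j"
    and cG: "\<And>W i. W \<in> carrier_mat d d \<Longrightarrow> i < d \<Longrightarrow> (\<Sum>j=1..K. col_sq (adj (G j) * W) i) \<le> col_sq W i"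
    by (rule row_polar_decomposition[OF P]) blast+
  obtain R H where R: "R \<in> carrier_mat d d" "adj R = R" "R * R = msum d K (\<lambda>j. Q j * adj (Q j))"
    and H: "\<And>j. j \<in> {1..K} \<Longrightarrow> H j \<in> carrier_mat d d" "\<And>j. j \<in> {1..K} \<Longrightarrow> Q j = R * H j"
    and cH: "\<And>W i. W \<in> carrier_mat d d \<Longrightarrow> i < d \<Longrightarrow> (\<Sum>j=1..K. col_sq (adj (H j) * W) i) \<le> col_sq W i"
    by (rule row_polar_decomposition[OF Q]) blast+
  define C where "C = msum d K (\<lambda>j. G j * adj (H j))"
  have C: "C \<in> carrier_mat d d" by (simp add: C_def)
  have "msum d K (\<lambda>j. P j * adj (Q j)) = msum d K (\<lambda>j. S * (G j * adj (H j) * R))"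
  proof (rule msum_cong)
    fix j assume j: "j \<in> {1..K}"
    show "P j * adj (Q j) = S * (G j * adj (H j) * R)"
      unfolding G(2)[OF j] H(2)[OF j] using S R G(1)[OF j] H(1)[OF j]
      by (simp add: adj_mult[of _ d d _ d] assoc_mult_mat[of _ d d _ d _ d])
  qed
  also have "\<dots> = S * msum d K (\<lambda>j. G j * adj (H j) * R)"
    using S R G(1) H(1) by (intro mult_msum_left[symmetric]) simp_all
  also have "msum d K (\<lambda>j. G j * adj (H j) * R) = C * R"
    unfolding C_def using R G(1) H(1) by (intro mult_msum_right[symmetric]) simp_all
  finally have M: "msum d K (\<lambda>j. P j * adj (Q j)) = S * (C * R)" .
  \<comment> \<open>Moving \<open>S\<close> cyclically to the end keeps the eigenvalues and leaves
    the contraction \<open>C\<close> outermost, where it only shortens columns.\<close>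
  define L where "L = R * S"
  have L: "L \<in> carrier_mat d d" using R S by (simp add: L_def)
  have "char_poly (C * L) = char_poly (S * (C * R))"
    using char_poly_mult_commute[of S d "C * R"] S C R
    by (simp add: L_def assoc_mult_mat[of _ d d _ d _ d])
  then have cpCL: "char_poly (C * L) = (\<Prod>i\<leftarrow>[0..<d]. [:- complex_of_real (m i), 1:])"
    using cp M by simp
  have CL: "C * L \<in> carrier_mat d d" using C L by simp
  obtain W where W: "unitary d W"
    and mW: "\<And>i. i < d \<Longrightarrow> (m i)\<^sup>2 \<le> col_sq (C * L * W) i"
    by (rule schur_basis[OF CL cpCL]) blast
  note W' = unitaryD[OF W]
  obtain V' l where V': "unitary d V'" and LL: "adj L * L = V' * rdiag d (\<lambda>i. (l i)\<^sup>2) * adj V'"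
    and l: "\<And>i. i < d \<Longrightarrow> 0 \<le> l i" "\<And>i j. i \<le> j \<Longrightarrow> j < d \<Longrightarrow> l j \<le> l i"
    using sing_vals_exist[OF L] by metis
  have "(m i)\<^sup>2 \<le> Re ((adj W * (adj L * L) * W) $$ (i,i))" if i: "i < d" for i
  proof -
    have LW: "L * W \<in> carrier_mat d d" using L W' by simp
    have "(m i)\<^sup>2 \<le> col_sq (C * L * W) i" by (rule mW[OF i])
    also have "C * L * W = C * (L * W)" using C L W' by (simp add: assoc_mult_mat[of _ d d _ d _ d])
    also have "col_sq \<dots> i \<le> col_sq (L * W) i"
      unfolding C_def by (rule contractive_rows_product[OF G(1) H(1) cG cH LW i])
    also have "\<dots> = Re ((adj (L * W) * (L * W)) $$ (i,i))" unfolding gram_diag[OF LW i] by simp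
    also have "adj (L * W) * (L * W) = adj W * (adj L * L) * W"
      using L W' by (simp add: adj_mult[of _ d d _ d] assoc_mult_mat[of _ d d _ d _ d])
    finally show ?thesis .
  qed
  then have "(\<Sum>i<k. (m i)\<^sup>2) \<le> (\<Sum>i<k. Re ((adj W * (adj L * L) * W) $$ (i,i)))"
    using k by (intro sum_mono) auto
  also have "\<dots> \<le> (\<Sum>i<k. (l i)\<^sup>2)"
    by (rule ky_fan_hermitian[OF W V' LL _ _ k]) (use l in \<open>auto intro!: power_mono\<close>)
  also have "\<dots> \<le> (\<Sum>i<k. s i)"
  proof -
    \<comment> \<open>Moving one \<open>S\<close> to the end shows that \<open>T\<close> has the
      eigenvalues of \<open>adj L * L\<close>. As \<open>T\<close> itself need not be Hermitian, a
      Schur basis and the singular value form of Ky Fan's inequality are used.\<close>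
    have T': "T = S * (S * (R * R))" unfolding T S(3)[symmetric] R(3)[symmetric]
      using S(1) R(1) by (simp add: assoc_mult_mat[of _ d d _ d _ d])
    then have Tc: "T \<in> carrier_mat d d" using S R(1) by simp
    have "char_poly T = char_poly (S * (R * R) * S)"
      unfolding T' by (rule char_poly_mult_commute[of S d]) (use S(1) R(1) in simp_all)
    also have "S * (R * R) * S = adj L * L"
      unfolding L_def using S(1,2) R(1,2) by (simp add: adj_mult[of _ d d _ d] assoc_mult_mat[of _ d d _ d _ d])
    also have "char_poly (adj L * L) = (\<Prod>i\<leftarrow>[0..<d]. [:- complex_of_real ((l i)\<^sup>2), 1:])"
      unfolding LL by (rule char_poly_unitary_rdiag[OF V'])
    finally have cpT: "char_poly T = (\<Prod>i\<leftarrow>[0..<d]. [:- complex_of_real ((l i)\<^sup>2), 1:])" .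
    obtain Z where Z: "unitary d Z"
      and lZ: "\<And>i. i < d \<Longrightarrow> (adj Z * T * Z) $$ (i,i) = complex_of_real ((l i)\<^sup>2)"
      by (rule schur_basis[OF Tc cpT]) blast
    have "(\<Sum>i<k. (l i)\<^sup>2) = (\<Sum>i<k. Re ((adj Z * T * Z) $$ (i,i)))"
      using k lZ by (intro sum.cong refl) (metis Re_complex_of_real lessThan_iff less_le_trans)
    also have "\<dots> \<le> (\<Sum>i<k. s i)"
      by (rule ky_fan_singular[OF Tc Z V TT s k])
    finally show ?thesis .
  qed
  finally show ?thesis .
qed

lemma rdiag_conj_square:
  assumes "unitary d U"
  shows "(U * rdiag d f * adj U) * (U * rdiag d f * adj U) = U * rdiag d (\<lambda>i. (f i)\<^sup>2) * adj U"
  using unitary_conj_mult[OF assms, of "rdiag d f" "rdiag d f"] by (simp add: power2_eq_square)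

theorem theorem2:
  fixes K d :: nat and A B :: "nat \<Rightarrow> complex mat"
  assumes "K \<ge> 1" and "d \<ge> 1"
    and "\<forall>k \<in> {1..K}. psd_mat d (A k) \<and> psd_mat d (B k) \<and> A k * B k = B k * A k"
  shows "weak_maj (sing_vals (msum d K (\<lambda>k. A k * B k)))
                  (sing_vals (msum d K A * msum d K B))"
proof -
  have "\<forall>j\<in>{1..K}. \<exists>R Q. R \<in> carrier_mat d d \<and> Q \<in> carrier_mat d d \<and> adj R = R \<and> adj Q = Q \<and>
    R * R = A j \<and> Q * Q = B j \<and> R * Q = Q * R"
    using assms(3) commuting_psd_roots by blast
  from bchoice[OF this] obtain R where "\<forall>j\<in>{1..K}. \<exists>Q. R j \<in> carrier_mat d d \<and> Q \<in> carrier_mat d d \<and>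
    adj (R j) = R j \<and> adj Q = Q \<and> R j * R j = A j \<and> Q * Q = B j \<and> R j * Q = Q * R j" by blast
  from bchoice[OF this] obtain Q where R: "\<And>j. j \<in> {1..K} \<Longrightarrow> R j \<in> carrier_mat d d"
      "\<And>j. j \<in> {1..K} \<Longrightarrow> adj (R j) = R j" "\<And>j. j \<in> {1..K} \<Longrightarrow> R j * R j = A j"
    and Q: "\<And>j. j \<in> {1..K} \<Longrightarrow> Q j \<in> carrier_mat d d"
      "\<And>j. j \<in> {1..K} \<Longrightarrow> adj (Q j) = Q j" "\<And>j. j \<in> {1..K} \<Longrightarrow> Q j * Q j = B j"
    and RQ: "\<And>j. j \<in> {1..K} \<Longrightarrow> R j * Q j = Q j * R j"
    by blast
  define X where "X j = R j * Q j" for j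
  have X: "X j \<in> carrier_mat d d" "adj (X j) = X j" if j: "j \<in> {1..K}" for j
    using R(1,2)[OF j] Q(1,2)[OF j] RQ[OF j] by (simp_all add: X_def adj_mult[of _ d d _ d])
  have XX: "X j * adj (X j) = A j * B j" if j: "j \<in> {1..K}" for j
  proof -
    have "X j * adj (X j) = R j * (Q j * R j) * Q j"
      unfolding X(2)[OF j] unfolding X_def using R(1)[OF j] Q(1)[OF j]
      by (simp add: assoc_mult_mat[of _ d d _ d _ d])
    also have "\<dots> = (R j * R j) * (Q j * Q j)"
      unfolding RQ[OF j, symmetric] using R(1)[OF j] Q(1)[OF j]
      by (simp add: assoc_mult_mat[of _ d d _ d _ d])
    also have "\<dots> = A j * B j" unfolding R(3)[OF j] Q(3)[OF j] ..
    finally show ?thesis .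
  qed
  \<comment> \<open>In this form \<open>Y\<close> is visibly positive semidefinite, so its
    eigenvalues \<open>y\<close> are also its singular values.\<close>
  define Y where "Y = msum d K (\<lambda>j. X j * adj (X j))"
  have Y_eq: "msum d K (\<lambda>k. A k * B k) = Y" unfolding Y_def using XX by (intro msum_cong) simp
  have Y: "Y \<in> carrier_mat d d" by (simp add: Y_def)
  have Yh: "adj Y = Y"
    unfolding Y_def using X by (subst adj_msum) (auto intro!: msum_cong simp: adj_mult[of _ d d _ d])
  obtain V y where V: "unitary d V" and YV: "Y = V * rdiag d y * adj V"
    and y_anti: "\<And>i j. i \<le> j \<Longrightarrow> j < d \<Longrightarrow> y j \<le> y i"
    using hermitian_spectral[OF Y Yh, of "\<lambda>x. x"] by metis
  note V' = unitaryD[OF V]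
  have y: "y i = (\<Sum>j=1..K. col_sq (X j * V) i)" if i: "i < d" for i
  proof -
    have "complex_of_real (y i) = (adj V * Y * V) $$ (i,i)"
      unfolding YV using i by (subst unitary_conj(2)[OF V]) (auto simp: mat_diag_def)
    also have "\<dots> = complex_of_real (\<Sum>j=1..K. col_sq (adj (X j) * V) i)"
      unfolding Y_def by (rule msum_gram_diag[OF X(1) V'(1) i])
    finally have "y i = (\<Sum>j=1..K. col_sq (adj (X j) * V) i)" by (simp only: of_real_eq_iff)
    also have "\<dots> = (\<Sum>j=1..K. col_sq (X j * V) i)"
      by (intro sum.cong refl) (simp only: X(2))
    finally show ?thesis .
  qed
  have y0: "0 \<le> y i" if "i < d" for i unfolding y[OF that] by (intro sum_nonneg) simp
  have YY: "adj Y * Y = V * rdiag d (\<lambda>i. (y i)\<^sup>2) * adj V"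
    unfolding Yh unfolding YV by (rule rdiag_conj_square[OF V])
  define T where "T = msum d K A * msum d K B"
  have T: "T \<in> carrier_mat d d" by (simp add: T_def)
  obtain V2 s where V2: "unitary d V2" and TT: "adj T * T = V2 * rdiag d (\<lambda>i. (s i)\<^sup>2) * adj V2"
    and s: "\<And>i. i < d \<Longrightarrow> 0 \<le> s i" "\<And>i j. i \<le> j \<Longrightarrow> j < d \<Longrightarrow> s j \<le> s i"
    using sing_vals_exist[OF T] by metis
  \<comment> \<open>The partial sums are compared one \<open>k\<close> at a time: the signs, and
    with them \<open>P\<close>, \<open>M\<close> and \<open>m\<close>, depend on \<open>k\<close>,
    while \<open>Y\<close>, \<open>T\<close> and \<open>s\<close> do not.\<close>
  have "(\<Sum>i<k. y i) \<le> (\<Sum>i<k. s i)" if k: "k \<le> d" for k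
  proof -
    have "\<exists>w. (\<forall>j. w j = 1 \<or> w j = - 1) \<and> (\<Sum>j=1..K. \<Sum>i<k. col_sq (X j * V) i) \<le>
        (\<Sum>i<k. col_sq (msum d K (\<lambda>j. complex_of_real (w j) \<cdot>\<^sub>m X j) * V) i)"
      by (rule sign_choice[OF V'(1) k X(1)])
    then obtain w where w: "\<And>j. w j = 1 \<or> w j = (- 1 :: real)" and
      le: "(\<Sum>j=1..K. \<Sum>i<k. col_sq (X j * V) i) \<le>
        (\<Sum>i<k. col_sq (msum d K (\<lambda>j. complex_of_real (w j) \<cdot>\<^sub>m X j) * V) i)"
      by blast
    \<comment> \<open>The signs are absorbed into the left factors. As they square to 1,
      \<open>P j * adj (P j)\<close> is still \<open>A j\<close>, so the bound by \<open>s\<close>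
      is the same for every choice of signs.\<close>
    define P where "P j = complex_of_real (w j) \<cdot>\<^sub>m R j" for j
    define M where "M = msum d K (\<lambda>j. P j * adj (Q j))"
    have P: "P j \<in> carrier_mat d d" if "j \<in> {1..K}" for j using R(1)[OF that] by (simp add: P_def)
    have PQ: "P j * adj (Q j) = complex_of_real (w j) \<cdot>\<^sub>m X j" if j: "j \<in> {1..K}" for j
      unfolding P_def X_def Q(2)[OF j] using R(1)[OF j] Q(1)[OF j] by (intro mult_smult_assoc_mat)
    have PP: "P j * adj (P j) = A j" if j: "j \<in> {1..K}" for j
    proof -
      have "adj (P j) = complex_of_real (w j) \<cdot>\<^sub>m adj (R j)"
        unfolding P_def using R(1)[OF j] by (intro eq_matI) auto
      then have "P j * adj (P j) = complex_of_real (w j) \<cdot>\<^sub>m (complex_of_real (w j) \<cdot>\<^sub>m A j)"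
        unfolding P_def using R[OF j]
        by (simp add: mult_smult_assoc_mat[of _ d d _ d] mult_smult_distrib[of _ d d _ d])
      also have "\<dots> = A j" using w[of j] by (intro eq_matI) auto
      finally show ?thesis .
    qed
    have M: "M \<in> carrier_mat d d" by (simp add: M_def)
    have M_eq: "M = msum d K (\<lambda>j. complex_of_real (w j) \<cdot>\<^sub>m X j)"
      unfolding M_def by (rule msum_cong) (rule PQ)
    have "adj (complex_of_real (w j) \<cdot>\<^sub>m X j) = complex_of_real (w j) \<cdot>\<^sub>m X j" if j: "j \<in> {1..K}" for j
    proof -
      have "adj (complex_of_real (w j) \<cdot>\<^sub>m X j) = complex_of_real (w j) \<cdot>\<^sub>m adj (X j)"
        using X(1)[OF j] by (intro eq_matI) auto
      then show ?thesis using X(2)[OF j] by simp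
    qed
    then have Mh: "adj M = M"
      unfolding M_eq using X(1) by (subst adj_msum) (auto intro!: msum_cong)
    \<comment> \<open>Ordered by square and not by value, since Ky Fan's principle will be applied
      to \<open>M * M\<close>.\<close>
    obtain U m where U: "unitary d U" and MU: "M = U * rdiag d m * adj U"
      and m: "\<And>i j. i \<le> j \<Longrightarrow> j < d \<Longrightarrow> (m j)\<^sup>2 \<le> (m i)\<^sup>2"
      using hermitian_spectral[OF M Mh, of "\<lambda>x. x\<^sup>2"] by metis
    have MM: "M * M = U * rdiag d (\<lambda>i. (m i)\<^sup>2) * adj U"
      unfolding MU by (rule rdiag_conj_square[OF U])
    \<comment> \<open>The first \<open>k\<close> columns of \<open>V\<close> realize the top
      eigenvalues of \<open>Y\<close>. For \<open>M * M\<close> they are merely some frame, so Ky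
      Fan's principle bounds the resulting sum by the \<open>k\<close> largest
      \<open>(m i)\<^sup>2\<close>.\<close>
    have "(\<Sum>i<k. y i) = (\<Sum>j=1..K. \<Sum>i<k. col_sq (X j * V) i)"
      using k y by (subst sum.swap) (intro sum.cong, auto)
    also have "\<dots> \<le> (\<Sum>i<k. col_sq (M * V) i)" using le unfolding M_eq .
    also have "\<dots> = (\<Sum>i<k. Re ((adj V * (M * M) * V) $$ (i,i)))"
    proof (intro sum.cong refl)
      fix i assume "i \<in> {..<k}"
      then have i: "i < d" using k by auto
      have MV: "M * V \<in> carrier_mat d d" using M V' by simp
      have "adj (M * V) * (M * V) = adj V * (M * M) * V"
        using M Mh V' by (simp add: adj_mult[of _ d d _ d] assoc_mult_mat[of _ d d _ d _ d])
      then show "col_sq (M * V) i = Re ((adj V * (M * M) * V) $$ (i,i))"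
        using gram_diag[OF MV i] by (metis Re_complex_of_real)
    qed
    also have "\<dots> \<le> (\<Sum>i<k. (m i)\<^sup>2)"
      by (rule ky_fan_hermitian[OF V U MM _ _ k]) (use m in auto)
    also have "\<dots> \<le> (\<Sum>i<k. s i)"
    proof (rule sum_sq_eigenvalues_le[OF P Q(1) _ _ V2 TT s k])
      show "char_poly (msum d K (\<lambda>j. P j * adj (Q j))) = (\<Prod>i\<leftarrow>[0..<d]. [:- complex_of_real (m i), 1:])"
        unfolding M_def[symmetric] MU by (rule char_poly_unitary_rdiag[OF U])
      have "msum d K A = msum d K (\<lambda>j. P j * adj (P j))" by (rule msum_cong) (simp only: PP)
      moreover have "msum d K B = msum d K (\<lambda>j. Q j * adj (Q j))"
        by (rule msum_cong) (simp only: Q(2,3))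
      ultimately show "T = msum d K (\<lambda>j. P j * adj (P j)) * msum d K (\<lambda>j. Q j * adj (Q j))"
        unfolding T_def by simp
    qed
    finally show ?thesis .
  qed
  then have "weak_maj (map y [0..<d]) (map s [0..<d])"
    by (intro weak_maj_map y_anti s)
  moreover have "sing_vals Y = map y [0..<d]" by (rule sing_vals_eqI[OF Y V YY y0 y_anti])
  moreover have "sing_vals T = map s [0..<d]" by (rule sing_vals_eqI[OF T V2 TT s])
  ultimately show ?thesis unfolding Y_eq T_def[symmetric] by simp
qed

end
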